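(* Let $(X,b,m)$ be a star-like graph for essential self-adjointness, with $X_1\subseteq X$ chosen as in the definition of star-like and $X_2=X\setminus X_1=\bigsqcup_{i\in I}\mathbb{N}_0^{(i)}$ the corresponding disjoint union of birth-death chains. Then the following statements are equivalent: (i) $L_c$ is essentially self-adjoint. (ii) $L_c^{(i)}$ is essentially self-adjoint for every $i\in I$. (iii) $$\sum_{r=0}^\infty \left( \sum_{k=0}^r \frac{1}{b\left(k^{(i)},(k+1)^{(i)}\right)} \right)^2 m\left((r+1)^{(i)}\right) = \infty$$ for every $i\in I$. (iv) For every $i\in I$, $\mathrm{Cap}_{2,2}(\infty^{(i)})=0$ or $\mathrm{Cap}_{2,2}(\infty^{(i)})=\infty$.
   Context: A weighted graph $(X,b,m)$ consists of a countably infinite set $X$, a symmetric $b\colon X\times X\to[0,\infty)$ vanishing on the diagonal with $\sum_y b(x,y)<\infty$ for all $x$, and $m\colon X\to(0,\infty)$. Assumption (A): $\sum_{y\in X} b^2(x,y)/m(y)<\infty$ for every $x\in X$. All functions are real-valued; $\ell^2(X,m)$ has inner product $\langle f,g\rangle=\sum_x f(x)g(x)m(x)$. The formal Laplacian is $\Delta f(x)=\frac1{m(x)}\sum_y b(x,y)(f(x)-f(y))$ for $f$ with $\sum_y b(x,y)|f(y)|<\infty$ for all $x$. $C_c(X)$ is the set of finitely supported functions; under (A), $L_c=\Delta|_{C_c(X)}$ is a symmetric positive operator on $\ell^2(X,m)$. An operator is essentially self-adjoint if it has a unique self-adjoint extension (equivalently, its closure is self-adjoint). The same notions apply to induced subgraphs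 (restricting $b$ and $m$ to a subset, possibly finite). A birth-death chain is a graph with vertex set $\mathbb{N}_0$ and $b(x,y)>0$ iff $|x-y|=1$. For $X_1\subseteq X$ and $X_2=X\setminus X_1$, let $(X_j,b_j,m_j)$ be the induced subgraphs and $L_{c,j}$ the corresponding Laplacian on $C_c(X_j)$ in $\ell^2(X_j,m_j)$, $j=1,2$. Let $\mathrm{Deg}_\partial(x)=\frac1{m(x)}\sum_{y\in X_2}b(x,y)$ for $x\in X_1$ and $\mathrm{Deg}_\partial(x)=\frac1{m(x)}\sum_{y\in X_1}b(x,y)$ for $x\in X_2$. A weighted graph satisfying (A) is star-like (for essential self-adjointness) if $X_1\subseteq X$ can be chosen so that (1) $L_{c,1}$ is essentially self-adjoint; (2) $\mathrm{Deg}_\partial$ is bounded; (3) $(X_2,b_2,m_2)$ is a disjoint union of birth-death chains. One writes $X_2=\bigsqcup_{i\in I}\mathbb{N}_0^{(i)}$ with $\mathbb{N}_0^{(i)}=\{k^{(i)}\}_{k=0}^\infty$, where $b(k^{(i)},l^{(j)})=0$ whenever $i\ne j$ and $b(k^{(i)},l^{(i)})>0$ iff $|k-l|=1$. $L_c^{(i)}$ is the Laplacian of the induced birth-death chain $(\mathbb{N}_0^{(i)},b,m)$ restricted to finitely supported functions. Capacity: for a birth-death chain $(\mathbb{N}_0,b,m)$, let $\mathcal{Q}(f)=\frac12\sum_{x,y}b(x,y)(f(x)-f(y))^2$, $H^2(\mathbb{N}_0,m)=\{f\in\ell^2(\mathbb{N}_0,m)\mid\Delta f\in\ell^2(\mathbb{N}_0,m),\mathcal{Q}(f)<\infty\}$,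 $\|f\|_{H^2}^2=\|f\|^2+\|\Delta f\|^2+\mathcal{Q}(f)$, and $\mathcal{C}_n=\{f\in H^2(\mathbb{N}_0,m)\mid f(r)=1\text{ for all }r\ge n\}$. Then $\mathrm{Cap}_{2,2}(\infty)=\infty$ if $\mathcal{C}_n=\emptyset$ for some $n\in\mathbb{N}_0$, and $\mathrm{Cap}_{2,2}(\infty)=\lim_{n\to\infty}\inf_{f\in\mathcal{C}_n}\|f\|_{H^2}^2$ otherwise. $\mathrm{Cap}_{2,2}(\infty^{(i)})$ is this quantity for the birth-death chain $(\mathbb{N}_0^{(i)},b,m)$. *)

theory Defs
  imports "HOL-Analysis.Analysis"
begin

section \<open>Weighted graphs\<close>

text \<open>
  A graph is given by a vertex set \<open>V\<close>, an edge weight \<open>b\<close> and a vertex weight \<open>m\<close>.  The values of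
  \<open>b\<close> and \<open>m\<close> outside \<open>V\<close> are never used, so the subgraph induced by a subset \<open>U\<close> is \<open>(U, b, m)\<close>
  with the same \<open>b\<close> and \<open>m\<close>.  A real function on \<open>V\<close> is represented by its extension by zero to
  the whole type, so that equality of functions on \<open>V\<close> is plain equality.
\<close>

definition weighted_graph :: "'a set \<Rightarrow> ('a \<Rightarrow> 'a \<Rightarrow> real) \<Rightarrow> ('a \<Rightarrow> real) \<Rightarrow> bool" where
  "weighted_graph X b m \<longleftrightarrow>
     countable X \<and> infinite X \<and>
     (\<forall>x\<in>X. \<forall>y\<in>X. 0 \<le> b x y \<and> b x y = b y x) \<and>
     (\<forall>x\<in>X. b x x = 0) \<and>
     (\<forall>x\<in>X. (\<lambda>y. b x y) summable_on X) \<and>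
     (\<forall>x\<in>X. 0 < m x)"

definition assumption_A :: "'a set \<Rightarrow> ('a \<Rightarrow> 'a \<Rightarrow> real) \<Rightarrow> ('a \<Rightarrow> real) \<Rightarrow> bool" where
  "assumption_A X b m \<longleftrightarrow> (\<forall>x\<in>X. (\<lambda>y. (b x y)\<^sup>2 / m y) summable_on X)"

definition ell2 :: "'a set \<Rightarrow> ('a \<Rightarrow> real) \<Rightarrow> ('a \<Rightarrow> real) set" where
  "ell2 V m = {f. (\<forall>x. x \<notin> V \<longrightarrow> f x = 0) \<and> (\<lambda>x. (f x)\<^sup>2 * m x) summable_on V}"

definition ell2_inner :: "'a set \<Rightarrow> ('a \<Rightarrow> real) \<Rightarrow> ('a \<Rightarrow> real) \<Rightarrow> ('a \<Rightarrow> real) \<Rightarrow> real" where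
  "ell2_inner V m f g = (\<Sum>\<^sub>\<infinity>x\<in>V. f x * g x * m x)"

definition ell2_norm :: "'a set \<Rightarrow> ('a \<Rightarrow> real) \<Rightarrow> ('a \<Rightarrow> real) \<Rightarrow> real" where
  "ell2_norm V m f = sqrt (ell2_inner V m f f)"

definition finitely_supported :: "'a set \<Rightarrow> ('a \<Rightarrow> real) set" where
  "finitely_supported V = {f. (\<forall>x. x \<notin> V \<longrightarrow> f x = 0) \<and> finite {x\<in>V. f x \<noteq> 0}}"

definition laplacian ::
  "'a set \<Rightarrow> ('a \<Rightarrow> 'a \<Rightarrow> real) \<Rightarrow> ('a \<Rightarrow> real) \<Rightarrow> ('a \<Rightarrow> real) \<Rightarrow> ('a \<Rightarrow> real)" where
  "laplacian V b m f =
     (\<lambda>x. if x \<in> V then 1 / m x * (\<Sum>\<^sub>\<infinity>y\<in>V. b x y * (f x - f y)) else 0)"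


section \<open>Unbounded operators on the weighted sequence space\<close>

text \<open>
  An operator is identified with its graph, a set of pairs \<open>(f, T f)\<close>; its domain is the
  \<^const>\<open>Domain\<close> of that relation, and \<open>S\<close> extends \<open>T\<close> iff \<open>T \<subseteq> S\<close>.
\<close>

definition ell2_operator ::
  "'a set \<Rightarrow> ('a \<Rightarrow> real) \<Rightarrow> (('a \<Rightarrow> real) \<times> ('a \<Rightarrow> real)) set \<Rightarrow> bool" where
  "ell2_operator V m T \<longleftrightarrow>
     T \<subseteq> ell2 V m \<times> ell2 V m \<and> single_valued T \<and>
     (\<lambda>x. 0, \<lambda>x. 0) \<in> T \<and>
     (\<forall>f h g k. (f, h) \<in> T \<longrightarrow> (g, k) \<in> T \<longrightarrow> (\<lambda>x. f x + g x, \<lambda>x. h x + k x) \<in> T) \<and>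
     (\<forall>c f h. (f, h) \<in> T \<longrightarrow> (\<lambda>x. c * f x, \<lambda>x. c * h x) \<in> T)"

definition densely_defined ::
  "'a set \<Rightarrow> ('a \<Rightarrow> real) \<Rightarrow> (('a \<Rightarrow> real) \<times> ('a \<Rightarrow> real)) set \<Rightarrow> bool" where
  "densely_defined V m T \<longleftrightarrow>
     (\<forall>g\<in>ell2 V m. \<forall>e>0. \<exists>f\<in>Domain T. ell2_norm V m (\<lambda>x. g x - f x) < e)"

definition adjoint_operator ::
  "'a set \<Rightarrow> ('a \<Rightarrow> real) \<Rightarrow> (('a \<Rightarrow> real) \<times> ('a \<Rightarrow> real)) set
     \<Rightarrow> (('a \<Rightarrow> real) \<times> ('a \<Rightarrow> real)) set" where
  "adjoint_operator V m T =
     {(g, h). g \<in> ell2 V m \<and> h \<in> ell2 V m \<and>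
              (\<forall>(f, k)\<in>T. ell2_inner V m k g = ell2_inner V m f h)}"

definition self_adjoint ::
  "'a set \<Rightarrow> ('a \<Rightarrow> real) \<Rightarrow> (('a \<Rightarrow> real) \<times> ('a \<Rightarrow> real)) set \<Rightarrow> bool" where
  "self_adjoint V m T \<longleftrightarrow>
     ell2_operator V m T \<and> densely_defined V m T \<and> adjoint_operator V m T = T"

definition essentially_self_adjoint ::
  "'a set \<Rightarrow> ('a \<Rightarrow> real) \<Rightarrow> (('a \<Rightarrow> real) \<times> ('a \<Rightarrow> real)) set \<Rightarrow> bool" where
  "essentially_self_adjoint V m T \<longleftrightarrow> (\<exists>!S. self_adjoint V m S \<and> T \<subseteq> S)"

definition L_c ::
  "'a set \<Rightarrow> ('a \<Rightarrow> 'a \<Rightarrow> real) \<Rightarrow> ('a \<Rightarrow> real) \<Rightarrow> (('a \<Rightarrow> real) \<times> ('a \<Rightarrow> real)) set" where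
  "L_c V b m = (\<lambda>f. (f, laplacian V b m f)) ` finitely_supported V"


section \<open>Birth-death chains and capacity at infinity\<close>

definition birth_death_chain :: "(nat \<Rightarrow> nat \<Rightarrow> real) \<Rightarrow> (nat \<Rightarrow> real) \<Rightarrow> bool" where
  "birth_death_chain b m \<longleftrightarrow>
     weighted_graph UNIV b m \<and> (\<forall>x y. 0 < b x y \<longleftrightarrow> \<bar>int x - int y\<bar> = 1)"

definition finite_energy :: "(nat \<Rightarrow> nat \<Rightarrow> real) \<Rightarrow> (nat \<Rightarrow> real) \<Rightarrow> bool" where
  "finite_energy b f \<longleftrightarrow> (\<lambda>(x, y). b x y * (f x - f y)\<^sup>2) summable_on UNIV"

definition energy :: "(nat \<Rightarrow> nat \<Rightarrow> real) \<Rightarrow> (nat \<Rightarrow> real) \<Rightarrow> real" where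
  "energy b f = 1 / 2 * (\<Sum>\<^sub>\<infinity>(x, y)\<in>UNIV. b x y * (f x - f y)\<^sup>2)"

definition H2 :: "(nat \<Rightarrow> nat \<Rightarrow> real) \<Rightarrow> (nat \<Rightarrow> real) \<Rightarrow> (nat \<Rightarrow> real) set" where
  "H2 b m = {f \<in> ell2 UNIV m. laplacian UNIV b m f \<in> ell2 UNIV m \<and> finite_energy b f}"

definition H2_norm_sq :: "(nat \<Rightarrow> nat \<Rightarrow> real) \<Rightarrow> (nat \<Rightarrow> real) \<Rightarrow> (nat \<Rightarrow> real) \<Rightarrow> real" where
  "H2_norm_sq b m f =
     (ell2_norm UNIV m f)\<^sup>2 + (ell2_norm UNIV m (laplacian UNIV b m f))\<^sup>2 + energy b f"

definition cap_class ::
  "(nat \<Rightarrow> nat \<Rightarrow> real) \<Rightarrow> (nat \<Rightarrow> real) \<Rightarrow> nat \<Rightarrow> (nat \<Rightarrow> real) set" where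
  "cap_class b m n = {f \<in> H2 b m. \<forall>r\<ge>n. f r = 1}"

definition Cap22 :: "(nat \<Rightarrow> nat \<Rightarrow> real) \<Rightarrow> (nat \<Rightarrow> real) \<Rightarrow> ereal" where
  "Cap22 b m =
     (if \<exists>n. cap_class b m n = {} then \<infinity>
      else lim (\<lambda>n. INF f\<in>cap_class b m n. ereal (H2_norm_sq b m f)))"


section \<open>Star-like graphs\<close>

definition boundary_degree ::
  "'a set \<Rightarrow> ('a \<Rightarrow> 'a \<Rightarrow> real) \<Rightarrow> ('a \<Rightarrow> real) \<Rightarrow> 'a set \<Rightarrow> 'a \<Rightarrow> real" where
  "boundary_degree X b m X1 x =
     1 / m x * (if x \<in> X1 then (\<Sum>\<^sub>\<infinity>y\<in>X - X1. b x y) else (\<Sum>\<^sub>\<infinity>y\<in>X1. b x y))"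

text \<open>The vertex \<open>v i k\<close> is the point \<open>k\<close> of the \<open>i\<close>-th copy of the natural numbers.\<close>

definition chain_b :: "('a \<Rightarrow> 'a \<Rightarrow> real) \<Rightarrow> (nat \<Rightarrow> 'a) \<Rightarrow> nat \<Rightarrow> nat \<Rightarrow> real" where
  "chain_b b w = (\<lambda>k l. b (w k) (w l))"

definition chain_m :: "('a \<Rightarrow> real) \<Rightarrow> (nat \<Rightarrow> 'a) \<Rightarrow> nat \<Rightarrow> real" where
  "chain_m m w = (\<lambda>k. m (w k))"

definition disjoint_union_of_chains ::
  "'a set \<Rightarrow> ('a \<Rightarrow> 'a \<Rightarrow> real) \<Rightarrow> ('a \<Rightarrow> real) \<Rightarrow> 'i set \<Rightarrow> ('i \<Rightarrow> nat \<Rightarrow> 'a) \<Rightarrow> bool" where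
  "disjoint_union_of_chains V b m I v \<longleftrightarrow>
     bij_betw (\<lambda>(i, k). v i k) (I \<times> UNIV) V \<and>
     (\<forall>i\<in>I. \<forall>j\<in>I. i \<noteq> j \<longrightarrow> (\<forall>k l. b (v i k) (v j l) = 0)) \<and>
     (\<forall>i\<in>I. birth_death_chain (chain_b b (v i)) (chain_m m (v i)))"

text \<open>
  The choice of \<open>X\<^sub>1\<close> and the labelling of the chains are parameters; \<open>(X, b, m)\<close> is star-like iff
  \<open>star_like X b m X1 I v\<close> holds for some \<open>X1\<close>, \<open>I\<close> and \<open>v\<close>.
\<close>

definition star_like ::
  "'a set \<Rightarrow> ('a \<Rightarrow> 'a \<Rightarrow> real) \<Rightarrow> ('a \<Rightarrow> real) \<Rightarrow> 'a set \<Rightarrow> 'i set \<Rightarrow> ('i \<Rightarrow> nat \<Rightarrow> 'a) \<Rightarrow> bool" where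
  "star_like X b m X1 I v \<longleftrightarrow>
     weighted_graph X b m \<and> assumption_A X b m \<and> X1 \<subseteq> X \<and>
     essentially_self_adjoint X1 m (L_c X1 b m) \<and>
     bounded (boundary_degree X b m X1 ` X) \<and>
     disjoint_union_of_chains (X - X1) b m I v"

end

(*
  Over the reals a pair (g, h) of the adjoint of a symmetric operator can always be adjoined
  without losing symmetry, since <h, g> = <g, h>.  By Zorn's lemma essential self-adjointness
  therefore just means that the adjoint is symmetric, and the adjoint of L_c is the formal
  Laplacian on its maximal domain in l^2.  If the vertex set is partitioned with bounded degree
  between the parts, cutting the edges between parts changes the Laplacian by a bounded symmetric
  operator, so symmetry can be tested on each part; this gives (i) <-> (ii).

  On a chain, s(x) = sum_{k<x} 1/b(k,k+1) and 1 are the solutions of Delta f = 0 off the origin.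
  If both lie in l^2, they violate symmetry.  Otherwise the increasing solution u of
  Delta u = -u is not in l^2; comparing f with multiples of u shows that f(n)/u(n) decays like
  the inverse norm of u on {0..n}, and so the Wronskian of two functions of the maximal domain
  tends to 0.  For the capacity, pairing with s bounds the H^2 norm below when s is in l^2;
  when it is not, explicit functions whose Laplacian is a small multiple of s on {1..M} have
  capacity tending to 0.
*)

theory Submission
  imports Defs
begin

section \<open>Self-adjoint extensions over the reals\<close>

text \<open>Closures never appear: every pair of the adjoint lies in some self-adjoint extension, so
  uniqueness of the extension forces symmetry of the adjoint, and the converse is formal. Assumption
  (A) is what puts the Laplacian of a point mass into \<open>ell2\<close>, and also what makes the
  sum of b(x,y) f(y) converge for f in \<open>ell2\<close>.

  On a chain, the mere fact that u is outside \<open>ell2\<close> does not control Wronskians, and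
  the decay of f/u alone would only bound them. They tend to 0 because the other factor, the pairing
  of u over {0..n} with an \<open>ell2\<close> function, is of smaller order than the norm of u on
  {0..n}.

  The test functions for the capacity are read off from the lower bound: if f(0) = 0 and f is 1 near
  infinity, then the Laplacian of f paired with \<open>s\<close> gives 1, so by Cauchy-Schwarz its
  norm on {0..M} is least when it is a multiple of \<open>s\<close>; the multiple is 1 /
  \<open>T M\<close>. If m is not summable, the capacity is infinite, and \<open>s\<close>, being
  bounded below away from the origin, is not square summable either.\<close>

lemma real_abs_summable:
  fixes f :: "'a \<Rightarrow> real"
  assumes "g summable_on A" "\<And>x. x \<in> A \<Longrightarrow> \<bar>f x\<bar> \<le> g x"
  shows "f summable_on A" "(\<lambda>x. \<bar>f x\<bar>) summable_on A"
proof -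
  show "(\<lambda>x. \<bar>f x\<bar>) summable_on A"
    by (rule summable_on_comparison_test[OF assms]) auto
  then show "f summable_on A"
    using abs_summable_summable[of f A] by simp
qed

lemma two_mult_le_squares: "2 * \<bar>a * b\<bar> \<le> a\<^sup>2 + (b::real)\<^sup>2"
  using sum_squares_bound[of "\<bar>a\<bar>" "\<bar>b\<bar>"] by (simp add: abs_mult)

lemma square_diff_bound: "(a - b)\<^sup>2 \<le> 2 * (a\<^sup>2 + (b::real)\<^sup>2)"
  using sum_squares_bound[of "-a" b] by (simp add: power2_diff)

lemma abs_le_one_plus_square: "\<bar>t\<bar> \<le> 1 + (t::real)\<^sup>2"
proof -
  have "2 * \<bar>t\<bar> \<le> 1 + t\<^sup>2" using two_mult_le_squares[of 1 t] by simp
  then show ?thesis using abs_ge_zero[of t] by linarith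
qed

lemma infsum_diff_real:
  fixes f g :: "'a \<Rightarrow> real"
  assumes "f summable_on A" "g summable_on A"
  shows "(\<Sum>\<^sub>\<infinity>x\<in>A. f x - g x) = infsum f A - infsum g A"
  using infsum_add[OF assms(1) summable_on_uminus[THEN iffD2, OF assms(2)]] by (simp add: infsum_uminus)

lemma summable_on_diff_real:
  fixes f g :: "'a \<Rightarrow> real"
  assumes "f summable_on A" "g summable_on A"
  shows "(\<lambda>x. f x - g x) summable_on A"
  using summable_on_add[OF assms(1) summable_on_uminus[THEN iffD2, OF assms(2)]] by simp

section \<open>Weighted sequence spaces as inner product spaces\<close>

locale ell2_space =
  fixes V :: "'a set" and m :: "'a \<Rightarrow> real"
  assumes m_pos: "x \<in> V \<Longrightarrow> 0 < m x"
begin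

lemma ell2_zero_outside: "f \<in> ell2 V m \<Longrightarrow> x \<notin> V \<Longrightarrow> f x = 0"
  and ell2_summable: "f \<in> ell2 V m \<Longrightarrow> (\<lambda>x. (f x)\<^sup>2 * m x) summable_on V"
  by (auto simp: ell2_def)

lemma ell2_mult_summable:
  assumes "f \<in> ell2 V m" "g \<in> ell2 V m"
  shows "(\<lambda>x. f x * g x * m x) summable_on V"
proof (rule real_abs_summable(1))
  show "(\<lambda>x. (f x)\<^sup>2 * m x + (g x)\<^sup>2 * m x) summable_on V"
    using assms by (intro summable_on_add) (auto simp: ell2_def)
  fix x assume "x \<in> V"
  then have "0 < m x" by (rule m_pos)
  moreover have "\<bar>f x * g x\<bar> \<le> (f x)\<^sup>2 + (g x)\<^sup>2"
    using two_mult_le_squares[of "f x" "g x"] by linarith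
  ultimately show "\<bar>f x * g x * m x\<bar> \<le> (f x)\<^sup>2 * m x + (g x)\<^sup>2 * m x"
    by (simp add: abs_mult[of _ "m x"] flip: distrib_right)
qed

lemma ell2_add:
  assumes "f \<in> ell2 V m" "g \<in> ell2 V m"
  shows "(\<lambda>x. f x + g x) \<in> ell2 V m"
proof -
  have "(\<lambda>x. ((f x)\<^sup>2 * m x + (g x)\<^sup>2 * m x) + 2 * (f x * g x * m x)) summable_on V"
    using assms by (intro summable_on_add summable_on_cmult_right ell2_mult_summable)
      (auto simp: ell2_def)
  then have "(\<lambda>x. (f x + g x)\<^sup>2 * m x) summable_on V"
    by (rule summable_on_cong[THEN iffD1, rotated]) (simp add: power2_eq_square algebra_simps)
  then show ?thesis using assms by (auto simp: ell2_def)
qed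

lemma ell2_scale:
  assumes "f \<in> ell2 V m"
  shows "(\<lambda>x. c * f x) \<in> ell2 V m"
proof -
  have "(\<lambda>x. c\<^sup>2 * ((f x)\<^sup>2 * m x)) summable_on V"
    using assms by (intro summable_on_cmult_right) (auto simp: ell2_def)
  then have "(\<lambda>x. (c * f x)\<^sup>2 * m x) summable_on V"
    by (simp add: power_mult_distrib mult.assoc)
  then show ?thesis using assms by (auto simp: ell2_def)
qed

lemma ell2_0: "(\<lambda>x. 0) \<in> ell2 V m"
  by (simp add: ell2_def)

lemma ell2_diff:
  assumes "f \<in> ell2 V m" "g \<in> ell2 V m"
  shows "(\<lambda>x. f x - g x) \<in> ell2 V m"
  using ell2_add[OF assms(1) ell2_scale[OF assms(2), of "-1"]] by simp

lemma inner_add_left: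
  assumes "f \<in> ell2 V m" "g \<in> ell2 V m" "h \<in> ell2 V m"
  shows "ell2_inner V m (\<lambda>x. f x + g x) h = ell2_inner V m f h + ell2_inner V m g h"
  using infsum_add[OF ell2_mult_summable[OF assms(1,3)] ell2_mult_summable[OF assms(2,3)]]
  by (simp add: ell2_inner_def algebra_simps)

lemma inner_diff_left:
  assumes "f \<in> ell2 V m" "g \<in> ell2 V m" "h \<in> ell2 V m"
  shows "ell2_inner V m (\<lambda>x. f x - g x) h = ell2_inner V m f h - ell2_inner V m g h"
  using infsum_diff_real[OF ell2_mult_summable[OF assms(1,3)] ell2_mult_summable[OF assms(2,3)]]
  by (simp add: ell2_inner_def algebra_simps)

lemma inner_commute: "ell2_inner V m f g = ell2_inner V m g f"
  by (simp add: ell2_inner_def mult.commute)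

lemma inner_scale_left: "ell2_inner V m (\<lambda>x. c * f x) g = c * ell2_inner V m f g"
  by (simp add: ell2_inner_def mult.assoc infsum_cmult_right')

lemma inner_scale_right: "ell2_inner V m f (\<lambda>x. c * g x) = c * ell2_inner V m f g"
  using inner_scale_left[of c g f] by (simp add: inner_commute)

lemma inner_add_right:
  assumes "f \<in> ell2 V m" "g \<in> ell2 V m" "h \<in> ell2 V m"
  shows "ell2_inner V m h (\<lambda>x. f x + g x) = ell2_inner V m h f + ell2_inner V m h g"
  using inner_add_left[OF assms] by (simp add: inner_commute)

lemma inner_diff_right:
  assumes "f \<in> ell2 V m" "g \<in> ell2 V m" "h \<in> ell2 V m"
  shows "ell2_inner V m h (\<lambda>x. f x - g x) = ell2_inner V m h f - ell2_inner V m h g"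
  using inner_diff_left[OF assms] by (simp add: inner_commute)

lemma inner_self_nonneg: "0 \<le> ell2_inner V m f f"
  unfolding ell2_inner_def by (rule infsum_nonneg) (simp add: less_imp_le[OF m_pos])

lemma inner_self_eq_0:
  assumes f: "f \<in> ell2 V m" and 0: "ell2_inner V m f f = 0"
  shows "f = (\<lambda>x. 0)"
proof
  fix x
  show "f x = 0"
  proof (cases "x \<in> V")
    case True
    have "f x * f x * m x = 0"
    proof (rule nonneg_infsum_le_0D[where A = V])
      show "(\<Sum>\<^sub>\<infinity>x\<in>V. f x * f x * m x) \<le> 0" using 0 by (simp add: ell2_inner_def)
    qed (use True f ell2_mult_summable[of f f] in \<open>simp_all add: less_imp_le[OF m_pos]\<close>)
    then show ?thesis using m_pos[OF True] by simp
  qed (use f ell2_zero_outside in auto)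
qed

lemma norm_sq: "(ell2_norm V m f)\<^sup>2 = ell2_inner V m f f"
  by (simp add: ell2_norm_def inner_self_nonneg)

lemma Cauchy_Schwarz_ell2:
  assumes f: "f \<in> ell2 V m" and g: "g \<in> ell2 V m"
  shows "\<bar>ell2_inner V m f g\<bar> \<le> ell2_norm V m f * ell2_norm V m g"
proof -
  define A where "A = ell2_inner V m g g"
  define B where "B = ell2_inner V m f g"
  define D where "D = ell2_inner V m f f"
  have nonneg: "0 \<le> D - 2 * t * B + t\<^sup>2 * A" for t
  proof -
    have tg: "(\<lambda>x. t * g x) \<in> ell2 V m" using g by (rule ell2_scale)
    have "ell2_inner V m (\<lambda>x. f x - t * g x) (\<lambda>x. f x - t * g x) = D - 2 * t * B + t\<^sup>2 * A"
      using f g tg ell2_diff[OF f tg]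
      by (simp add: inner_diff_left inner_diff_right inner_scale_left inner_scale_right
          A_def B_def D_def inner_commute[of g f] power2_eq_square right_diff_distrib)
    then show ?thesis using inner_self_nonneg by metis
  qed
  have "B\<^sup>2 \<le> D * A"
  proof (cases "A = 0")
    case True
    then have "g = (\<lambda>x. 0)" using inner_self_eq_0[OF g] A_def by simp
    then show ?thesis by (simp add: True B_def ell2_inner_def)
  next
    case False
    then have "A > 0" using inner_self_nonneg[of g] A_def by simp
    with nonneg[of "B / A"] show ?thesis by (simp add: field_simps power2_eq_square)
  qed
  then have "\<bar>B\<bar> \<le> sqrt (D * A)" using real_le_rsqrt[of "\<bar>B\<bar>"] by simp
  then show ?thesis by (simp add: real_sqrt_mult ell2_norm_def A_def B_def D_def)
qed

section \<open>Linear relations, adjoints and symmetric extensions\<close>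

abbreviation "linear_relation M \<equiv> M \<subseteq> ell2 V m \<times> ell2 V m \<and> (\<lambda>x. 0, \<lambda>x. 0) \<in> M \<and>
   (\<forall>f h g k. (f, h) \<in> M \<longrightarrow> (g, k) \<in> M \<longrightarrow> (\<lambda>x. f x + g x, \<lambda>x. h x + k x) \<in> M) \<and>
   (\<forall>c f h. (f, h) \<in> M \<longrightarrow> (\<lambda>x. c * f x, \<lambda>x. c * h x) \<in> M)"

abbreviation symmetric_operator where
  "symmetric_operator M \<equiv> ell2_operator V m M \<and> M \<subseteq> adjoint_operator V m M"

lemma mem_adjoint_iff:
  "(g, h) \<in> adjoint_operator V m T \<longleftrightarrow> g \<in> ell2 V m \<and> h \<in> ell2 V m \<and>
     (\<forall>f k. (f, k) \<in> T \<longrightarrow> ell2_inner V m k g = ell2_inner V m f h)"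
  by (auto simp: adjoint_operator_def)

lemma adjoint_antimono: "S \<subseteq> T \<Longrightarrow> adjoint_operator V m T \<subseteq> adjoint_operator V m S"
  by (fastforce simp: mem_adjoint_iff)

lemma densely_defined_mono: "densely_defined V m S \<Longrightarrow> S \<subseteq> T \<Longrightarrow> densely_defined V m T"
  unfolding densely_defined_def by (meson Domain_mono subsetD)

text \<open>Single-valuedness is left out on purpose: the adjoint is a linear relation in any case
  and becomes an operator through density of the domain of \<open>T\<close>.\<close>

lemma adjoint_linear:
  assumes "T \<subseteq> ell2 V m \<times> ell2 V m"
  shows "linear_relation (adjoint_operator V m T)"
proof (intro conjI allI impI)
  show "adjoint_operator V m T \<subseteq> ell2 V m \<times> ell2 V m" by (auto simp: mem_adjoint_iff)
  have "ell2_inner V m k (\<lambda>x. 0) = 0" for k by (simp add: ell2_inner_def)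
  moreover have "ell2_inner V m (\<lambda>x. 0) k = 0" for k by (simp add: ell2_inner_def)
  ultimately show "(\<lambda>x. 0, \<lambda>x. 0) \<in> adjoint_operator V m T" by (simp add: mem_adjoint_iff ell2_0)
next
  fix f h g k assume *: "(f, h) \<in> adjoint_operator V m T" "(g, k) \<in> adjoint_operator V m T"
  then have e: "f \<in> ell2 V m" "h \<in> ell2 V m" "g \<in> ell2 V m" "k \<in> ell2 V m"
    by (auto simp: mem_adjoint_iff)
  have "ell2_inner V m q (\<lambda>x. f x + g x) = ell2_inner V m p (\<lambda>x. h x + k x)" if "(p, q) \<in> T" for p q
  proof -
    have "p \<in> ell2 V m" "q \<in> ell2 V m" using that assms by auto
    then show ?thesis using that * e by (simp add: inner_add_right mem_adjoint_iff)
  qed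
  then show "(\<lambda>x. f x + g x, \<lambda>x. h x + k x) \<in> adjoint_operator V m T"
    using e by (simp add: mem_adjoint_iff ell2_add)
next
  fix c f h assume "(f, h) \<in> adjoint_operator V m T"
  then show "(\<lambda>x. c * f x, \<lambda>x. c * h x) \<in> adjoint_operator V m T"
    by (simp add: mem_adjoint_iff ell2_scale inner_scale_right)
qed

text \<open>The difference w of two values is orthogonal to the domain. An f in the domain closer to
  w than the norm of w would satisfy <w - f, w> = <w, w>, against Cauchy-Schwarz.\<close>

lemma adjoint_single_valued:
  assumes dense: "densely_defined V m T" and T: "T \<subseteq> ell2 V m \<times> ell2 V m"
  shows "single_valued (adjoint_operator V m T)"
proof (rule single_valuedI)
  fix g h h' assume gh: "(g, h) \<in> adjoint_operator V m T" "(g, h') \<in> adjoint_operator V m T"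
  define w where "w = (\<lambda>x. h x - h' x)"
  have h: "h \<in> ell2 V m" "h' \<in> ell2 V m" using gh by (auto simp: mem_adjoint_iff)
  have w: "w \<in> ell2 V m" unfolding w_def using h by (rule ell2_diff)
  have ortho: "ell2_inner V m f w = 0" if f: "f \<in> Domain T" for f
  proof -
    obtain k where "(f, k) \<in> T" using f by blast
    moreover have "f \<in> ell2 V m" using f T by auto
    ultimately show ?thesis
      using gh h by (simp add: w_def inner_diff_right mem_adjoint_iff) (metis right_minus_eq)
  qed
  have "ell2_norm V m w = 0"
  proof (rule ccontr)
    assume "ell2_norm V m w \<noteq> 0"
    then have pos: "ell2_norm V m w > 0" by (simp add: ell2_norm_def inner_self_nonneg less_le)
    then obtain f where f: "f \<in> Domain T" "ell2_norm V m (\<lambda>x. w x - f x) < ell2_norm V m w"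
      using dense w unfolding densely_defined_def by blast
    have fe: "f \<in> ell2 V m" using f(1) T by auto
    have "(ell2_norm V m w)\<^sup>2 = ell2_inner V m (\<lambda>x. w x - f x) w"
      using w fe ortho[OF f(1)] by (simp add: norm_sq inner_diff_left)
    also have "\<dots> \<le> ell2_norm V m (\<lambda>x. w x - f x) * ell2_norm V m w"
      using Cauchy_Schwarz_ell2[OF ell2_diff[OF w fe] w] by linarith
    also have "\<dots> < ell2_norm V m w * ell2_norm V m w" using f(2) pos by simp
    finally show False by (simp add: power2_eq_square)
  qed
  then have "w = (\<lambda>x. 0)"
    using inner_self_eq_0[OF w] norm_sq[of w] by simp
  then show "h = h'" by (auto simp: w_def fun_eq_iff)
qed

lemma symmetric_operator_extend:
  assumes M: "symmetric_operator M" and dense: "densely_defined V m M"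
    and gh: "(g, h) \<in> adjoint_operator V m M"
  shows "\<exists>N. symmetric_operator N \<and> M \<subseteq> N \<and> (g, h) \<in> N"
proof -
  define N where "N = {(\<lambda>x. f x + c * g x, \<lambda>x. k x + c * h x) | f k c. (f, k) \<in> M}"
  have Mlin: "linear_relation M" using M by (simp add: ell2_operator_def)
  have NI: "(\<lambda>x. f x + c * g x, \<lambda>x. k x + c * h x) \<in> N" if "(f, k) \<in> M" for f k c
    using that unfolding N_def by blast
  have ghe: "g \<in> ell2 V m" "h \<in> ell2 V m" using gh by (auto simp: mem_adjoint_iff)
  have Me: "f \<in> ell2 V m" "k \<in> ell2 V m" if "(f, k) \<in> M" for f k
    using that Mlin by auto
  have MN: "M \<subseteq> N"
    using NI[where c = 0] by auto
  have ghN: "(g, h) \<in> N"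
    using NI[of "\<lambda>x. 0" "\<lambda>x. 0" 1] Mlin by simp
  have sub: "N \<subseteq> ell2 V m \<times> ell2 V m"
    unfolding N_def using Me ghe by (auto intro!: ell2_add ell2_scale)
  have Nadd: "(\<lambda>x. p x + p' x, \<lambda>x. q x + q' x) \<in> N" if "(p, q) \<in> N" "(p', q') \<in> N" for p q p' q'
  proof -
    obtain f k c where 1: "p = (\<lambda>x. f x + c * g x)" "q = (\<lambda>x. k x + c * h x)" "(f, k) \<in> M"
      using \<open>(p, q) \<in> N\<close> unfolding N_def by auto
    obtain f' k' c' where 2: "p' = (\<lambda>x. f' x + c' * g x)" "q' = (\<lambda>x. k' x + c' * h x)" "(f', k') \<in> M"
      using \<open>(p', q') \<in> N\<close> unfolding N_def by auto
    have "(\<lambda>x. f x + f' x, \<lambda>x. k x + k' x) \<in> M" using Mlin 1(3) 2(3) by blast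
    from NI[OF this, of "c + c'"] show ?thesis by (simp add: 1 2 algebra_simps)
  qed
  have Nscale: "(\<lambda>x. a * p x, \<lambda>x. a * q x) \<in> N" if "(p, q) \<in> N" for a p q
  proof -
    obtain f k c where 1: "p = (\<lambda>x. f x + c * g x)" "q = (\<lambda>x. k x + c * h x)" "(f, k) \<in> M"
      using \<open>(p, q) \<in> N\<close> unfolding N_def by auto
    have "(\<lambda>x. a * f x, \<lambda>x. a * k x) \<in> M" using Mlin 1(3) by blast
    from NI[OF this, of "a * c"] show ?thesis by (simp add: 1 algebra_simps)
  qed
  have sym: "N \<subseteq> adjoint_operator V m N"
  proof (rule subrelI)
    fix p q assume pq: "(p, q) \<in> N"
    then obtain f k c where 1: "p = (\<lambda>x. f x + c * g x)" "q = (\<lambda>x. k x + c * h x)" "(f, k) \<in> M"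
      unfolding N_def by auto
    have "ell2_inner V m q' p = ell2_inner V m p' q" if p'q': "(p', q') \<in> N" for p' q'
    proof -
      obtain f' k' c' where 2: "p' = (\<lambda>x. f' x + c' * g x)" "q' = (\<lambda>x. k' x + c' * h x)" "(f', k') \<in> M"
        using p'q' unfolding N_def by auto
      have "ell2_inner V m k' f = ell2_inner V m f' k"
        using M 1(3) 2(3) by (auto simp: mem_adjoint_iff)
      moreover have "ell2_inner V m k' g = ell2_inner V m f' h" "ell2_inner V m k g = ell2_inner V m f h"
        using gh 1(3) 2(3) by (auto simp: mem_adjoint_iff)
      ultimately show ?thesis
        using Me[OF 1(3)] Me[OF 2(3)] ghe
        by (simp add: 1 2 inner_add_left inner_add_right ell2_add ell2_scale inner_scale_left
            inner_scale_right inner_commute[of h] inner_commute[of g k] algebra_simps)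
    qed
    then show "(p, q) \<in> adjoint_operator V m N"
      using pq sub by (auto simp: mem_adjoint_iff)
  qed
  \<comment> \<open>A symmetric relation with dense domain is contained in its adjoint, which is
    single-valued; no separate argument is needed for the case that g already lies in the domain of
    \<open>M\<close>.\<close>
  have "single_valued N"
    using single_valued_subset[OF sym] adjoint_single_valued[OF densely_defined_mono[OF dense MN] sub]
    by simp
  then have "ell2_operator V m N"
    unfolding ell2_operator_def
  proof (intro conjI allI impI)
    show "(\<lambda>x. 0, \<lambda>x. 0) \<in> N" using MN Mlin by blast
  qed (use sub Nadd Nscale in simp_all)
  then show ?thesis using sym MN ghN by blast
qed

text \<open>Linearity, single-valuedness and symmetry each involve at most two pairs, and two pairs
  from the union of a chain lie in a common member.\<close>

lemma symmetric_operator_Union: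
  assumes ne: "\<C> \<noteq> {}" and ch: "subset.chain {M. symmetric_operator M \<and> S \<subseteq> M} \<C>"
  shows "symmetric_operator (\<Union>\<C>) \<and> S \<subseteq> \<Union>\<C>"
proof -
  have C: "symmetric_operator M" "S \<subseteq> M" if "M \<in> \<C>" for M
    using that ch unfolding subset.chain_def by auto
  have common: "\<exists>M\<in>\<C>. p \<in> M \<and> q \<in> M" if pq: "p \<in> \<Union>\<C>" "q \<in> \<Union>\<C>" for p q
  proof -
    obtain M N where "M \<in> \<C>" "p \<in> M" "N \<in> \<C>" "q \<in> N" using pq by blast
    moreover from this have "M \<subseteq> N \<or> N \<subseteq> M" using ch unfolding subset.chain_def by blast
    ultimately show ?thesis by blast
  qed
  have "ell2_operator V m (\<Union>\<C>)"
    unfolding ell2_operator_def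
  proof (intro conjI allI impI)
    show "\<Union>\<C> \<subseteq> ell2 V m \<times> ell2 V m" using C(1) unfolding ell2_operator_def by blast
    show "single_valued (\<Union>\<C>)"
    proof (rule single_valuedI)
      fix x y z assume "(x, y) \<in> \<Union>\<C>" "(x, z) \<in> \<Union>\<C>"
      then obtain M where "M \<in> \<C>" "(x, y) \<in> M" "(x, z) \<in> M" using common by meson
      then show "y = z" using C(1)[of M] unfolding ell2_operator_def single_valued_def by blast
    qed
    show "(\<lambda>x. 0, \<lambda>x. 0) \<in> \<Union>\<C>" using ne C(1) unfolding ell2_operator_def by blast
  next
    fix f h g k assume "(f, h) \<in> \<Union>\<C>" "(g, k) \<in> \<Union>\<C>"
    then obtain M where M: "M \<in> \<C>" "(f, h) \<in> M" "(g, k) \<in> M" using common by meson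
    then have "(\<lambda>x. f x + g x, \<lambda>x. h x + k x) \<in> M" using C(1)[of M] unfolding ell2_operator_def by blast
    then show "(\<lambda>x. f x + g x, \<lambda>x. h x + k x) \<in> \<Union>\<C>" using M(1) by blast
  next
    fix c f h assume "(f, h) \<in> \<Union>\<C>"
    then obtain M where M: "M \<in> \<C>" "(f, h) \<in> M" by blast
    then have "(\<lambda>x. c * f x, \<lambda>x. c * h x) \<in> M" using C(1)[of M] unfolding ell2_operator_def by blast
    then show "(\<lambda>x. c * f x, \<lambda>x. c * h x) \<in> \<Union>\<C>" using M(1) by blast
  qed
  moreover have "\<Union>\<C> \<subseteq> adjoint_operator V m (\<Union>\<C>)"
  proof (rule subrelI)
    fix g h assume gh: "(g, h) \<in> \<Union>\<C>"
    have "ell2_inner V m k g = ell2_inner V m f h" if fk: "(f, k) \<in> \<Union>\<C>" for f k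
    proof -
      obtain M where "M \<in> \<C>" "(g, h) \<in> M" "(f, k) \<in> M" using common[OF gh fk] by blast
      then show ?thesis using C(1)[of M] by (auto simp: mem_adjoint_iff)
    qed
    moreover obtain M where "M \<in> \<C>" "(g, h) \<in> M" using gh by blast
    then have "(g, h) \<in> adjoint_operator V m M" using C(1)[of M] by blast
    then have "g \<in> ell2 V m" "h \<in> ell2 V m" by (auto simp: mem_adjoint_iff)
    ultimately show "(g, h) \<in> adjoint_operator V m (\<Union>\<C>)" by (auto simp: mem_adjoint_iff)
  qed
  ultimately show ?thesis using ne C(2) by blast
qed

text \<open>A maximal symmetric extension is self-adjoint, since any pair of its adjoint could be
  adjoined to it. The prescribed pair (g, h) is the point: if the self-adjoint extension is unique,
  it must contain the whole adjoint of \<open>T\<close>.\<close>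

lemma exists_self_adjoint_extension:
  assumes T: "symmetric_operator T" and dense: "densely_defined V m T"
    and gh: "(g, h) \<in> adjoint_operator V m T"
  shows "\<exists>S. self_adjoint V m S \<and> T \<subseteq> S \<and> (g, h) \<in> S"
proof -
  obtain N where N: "symmetric_operator N" "T \<subseteq> N" "(g, h) \<in> N"
    using symmetric_operator_extend[OF T dense gh] by blast
  let ?F = "{M. symmetric_operator M \<and> N \<subseteq> M}"
  have "\<exists>M\<in>?F. \<forall>X\<in>?F. M \<subseteq> X \<longrightarrow> X = M"
  proof (rule subset_Zorn_nonempty)
    show "?F \<noteq> {}" using N by blast
    show "\<Union>\<C> \<in> ?F" if "\<C> \<noteq> {}" "subset.chain ?F \<C>" for \<C>
      using symmetric_operator_Union[OF that] by simp
  qed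
  then obtain M where MF: "M \<in> ?F" and maxF: "\<forall>X\<in>?F. M \<subseteq> X \<longrightarrow> X = M" by (rule bexE)
  have M: "symmetric_operator M" "N \<subseteq> M" using MF by simp_all
  have max: "X = M" if "symmetric_operator X" "M \<subseteq> X" for X
    using maxF[rule_format, of X] that M(2) by simp
  have dM: "densely_defined V m M" using densely_defined_mono[OF dense] N(2) M(2) by blast
  have "adjoint_operator V m M \<subseteq> M"
  proof (rule subrelI)
    fix p q assume "(p, q) \<in> adjoint_operator V m M"
    from symmetric_operator_extend[OF M(1) dM this] obtain X
      where "symmetric_operator X" "M \<subseteq> X" "(p, q) \<in> X" by blast
    with max[of X] show "(p, q) \<in> M" by simp
  qed
  then have "self_adjoint V m M" using M(1) dM by (auto simp: self_adjoint_def)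
  then show ?thesis using M(2) N by blast
qed

text \<open>If S is the only extension, it contains the adjoint A of \<open>T\<close>, so S, being
  its own adjoint, lies in the adjoint of A. Conversely a symmetric A is self-adjoint, because
  \<open>T\<close> lies in A; any self-adjoint S above \<open>T\<close> lies in A, and taking
  adjoints reverses this inclusion.\<close>

lemma essentially_self_adjoint_iff_adjoint_symmetric:
  assumes T: "symmetric_operator T" and dense: "densely_defined V m T"
  shows "essentially_self_adjoint V m T \<longleftrightarrow>
    adjoint_operator V m T \<subseteq> adjoint_operator V m (adjoint_operator V m T)"
    (is "_ \<longleftrightarrow> ?A \<subseteq> _")
proof
  assume "essentially_self_adjoint V m T"
  then obtain S where S: "self_adjoint V m S" "T \<subseteq> S"
    and uniq: "\<And>S'. self_adjoint V m S' \<Longrightarrow> T \<subseteq> S' \<Longrightarrow> S' = S"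
    unfolding essentially_self_adjoint_def by blast
  have "?A \<subseteq> S"
    using exists_self_adjoint_extension[OF T dense] uniq by (metis subrelI)
  then have "adjoint_operator V m S \<subseteq> adjoint_operator V m ?A" by (rule adjoint_antimono)
  then show "?A \<subseteq> adjoint_operator V m ?A"
    using \<open>?A \<subseteq> S\<close> S(1) by (auto simp: self_adjoint_def)
next
  assume sym: "?A \<subseteq> adjoint_operator V m ?A"
  have TA: "T \<subseteq> ?A" using T by blast
  have "T \<subseteq> ell2 V m \<times> ell2 V m" using T by (simp add: ell2_operator_def)
  then have "ell2_operator V m ?A"
    unfolding ell2_operator_def using adjoint_linear[of T] adjoint_single_valued[OF dense] by simp
  then have sa: "self_adjoint V m ?A"
    unfolding self_adjoint_def
    using sym densely_defined_mono[OF dense TA] adjoint_antimono[OF TA] by blast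
  moreover have "S = ?A" if "self_adjoint V m S" "T \<subseteq> S" for S
  proof -
    have 1: "S \<subseteq> ?A" using adjoint_antimono[OF that(2)] that(1) by (simp add: self_adjoint_def)
    then have "adjoint_operator V m ?A \<subseteq> adjoint_operator V m S" by (rule adjoint_antimono)
    then show ?thesis using 1 that(1) sa by (auto simp: self_adjoint_def)
  qed
  ultimately show "essentially_self_adjoint V m T"
    unfolding essentially_self_adjoint_def using TA by blast
qed

end

section \<open>The formal Laplacian\<close>

text \<open>The working form of essential self-adjointness: it mentions neither adjoints nor
  extensions, so it can be cut along a partition and transported along a relabelling.\<close>

definition max_symmetric ::
  "'a set \<Rightarrow> ('a \<Rightarrow> 'a \<Rightarrow> real) \<Rightarrow> ('a \<Rightarrow> real) \<Rightarrow> bool" where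
  "max_symmetric V b m \<longleftrightarrow>
     (\<forall>f\<in>ell2 V m. \<forall>g\<in>ell2 V m.
        laplacian V b m f \<in> ell2 V m \<longrightarrow> laplacian V b m g \<in> ell2 V m \<longrightarrow>
        ell2_inner V m (laplacian V b m f) g = ell2_inner V m f (laplacian V b m g))"

text \<open>Only properties that pass to every subset of the vertices are collected here, so that
  the whole graph, the possibly finite set X1 and every chain are instances.\<close>

locale graph_weights = ell2_space V m
  for V :: "'a set" and m :: "'a \<Rightarrow> real" +
  fixes b :: "'a \<Rightarrow> 'a \<Rightarrow> real"
  assumes b_nonneg: "x \<in> V \<Longrightarrow> y \<in> V \<Longrightarrow> 0 \<le> b x y"
    and b_sym: "x \<in> V \<Longrightarrow> y \<in> V \<Longrightarrow> b x y = b y x"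
    and b_summable: "x \<in> V \<Longrightarrow> b x summable_on V"
    and b_sq_summable: "x \<in> V \<Longrightarrow> (\<lambda>y. (b x y)\<^sup>2 / m y) summable_on V"
begin

text \<open>By (A), b(x,y) / sqrt (m y) is square summable in y, and so is f(y) sqrt (m y): every
  \<open>ell2\<close> function is in the domain of the formal Laplacian.\<close>

lemma b_mult_summable:
  assumes f: "f \<in> ell2 V m" and x: "x \<in> V"
  shows "(\<lambda>y. b x y * f y) summable_on V"
proof (rule real_abs_summable(1))
  show "(\<lambda>y. (b x y)\<^sup>2 / m y + (f y)\<^sup>2 * m y) summable_on V"
    by (intro summable_on_add b_sq_summable[OF x] ell2_summable[OF f])
  fix y assume "y \<in> V"
  then have "0 < m y" by (rule m_pos)
  then show "\<bar>b x y * f y\<bar> \<le> (b x y)\<^sup>2 / m y + (f y)\<^sup>2 * m y"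
    using two_mult_le_squares[of "b x y / sqrt (m y)" "f y * sqrt (m y)"]
    by (simp add: power_divide power_mult_distrib)
qed

lemma laplacian_eq:
  assumes f: "f \<in> ell2 V m" and x: "x \<in> V"
  shows "laplacian V b m f x = (f x * infsum (b x) V - (\<Sum>\<^sub>\<infinity>y\<in>V. b x y * f y)) / m x"
proof -
  have "(\<Sum>\<^sub>\<infinity>y\<in>V. f x * b x y - b x y * f y) = f x * infsum (b x) V - (\<Sum>\<^sub>\<infinity>y\<in>V. b x y * f y)"
    using infsum_diff_real[OF summable_on_cmult_right[OF b_summable[OF x]] b_mult_summable[OF f x]]
    by (simp add: infsum_cmult_right')
  then show ?thesis
    using x by (simp add: laplacian_def right_diff_distrib[of "b _ _"] mult.commute[of "f x"])
qed

lemma laplacian_outside: "x \<notin> V \<Longrightarrow> laplacian V b m f x = 0"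
  by (simp add: laplacian_def)

lemma laplacian_add:
  assumes f: "f \<in> ell2 V m" and g: "g \<in> ell2 V m"
  shows "laplacian V b m (\<lambda>x. f x + g x) = (\<lambda>x. laplacian V b m f x + laplacian V b m g x)"
proof
  fix x
  show "laplacian V b m (\<lambda>x. f x + g x) x = laplacian V b m f x + laplacian V b m g x"
  proof (cases "x \<in> V")
    case True
    have "(\<Sum>\<^sub>\<infinity>y\<in>V. b x y * (f y + g y)) = (\<Sum>\<^sub>\<infinity>y\<in>V. b x y * f y) + (\<Sum>\<^sub>\<infinity>y\<in>V. b x y * g y)"
      using infsum_add[OF b_mult_summable[OF f True] b_mult_summable[OF g True]]
      by (simp add: distrib_left)
    then show ?thesis
      using True f g ell2_add[OF f g] by (simp add: laplacian_eq distrib_right add_divide_distrib diff_divide_distrib)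
  qed (simp add: laplacian_outside)
qed

lemma laplacian_scale: "laplacian V b m (\<lambda>x. c * f x) = (\<lambda>x. c * laplacian V b m f x)"
proof
  fix x
  have "(\<Sum>\<^sub>\<infinity>y\<in>V. b x y * (c * f x - c * f y)) = c * (\<Sum>\<^sub>\<infinity>y\<in>V. b x y * (f x - f y))"
    by (simp add: infsum_cmult_right'[symmetric] algebra_simps)
  then show "laplacian V b m (\<lambda>x. c * f x) x = c * laplacian V b m f x"
    by (simp add: laplacian_def)
qed

lemma finitely_supported_ell2: "f \<in> finitely_supported V \<Longrightarrow> f \<in> ell2 V m"
  by (auto simp: finitely_supported_def ell2_def intro!: finite_nonzero_values_imp_summable_on
      elim!: rev_finite_subset)

text \<open>Off z the Laplacian of the point mass at z is - b(z,x) / m(x), whose square summability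
  is exactly (A). Symmetry of \<open>b\<close> turns the pairing with it into the Laplacian of g at
  z.\<close>

lemma laplacian_delta:
  fixes z
  defines "d \<equiv> (\<lambda>x. if x = z then 1 else 0 :: real)"
  assumes z: "z \<in> V"
  shows "d \<in> ell2 V m" "laplacian V b m d \<in> ell2 V m"
    and "g \<in> ell2 V m \<Longrightarrow> ell2_inner V m (laplacian V b m d) g = laplacian V b m g z * m z"
proof -
  show d: "d \<in> ell2 V m"
    using z by (intro finitely_supported_ell2) (auto simp: finitely_supported_def d_def)
  have bz: "(\<Sum>\<^sub>\<infinity>y\<in>V. b x y * d y) = b x z" for x
  proof -
    have "(\<Sum>\<^sub>\<infinity>y\<in>V. b x y * d y) = (\<Sum>\<^sub>\<infinity>y\<in>{z}. b x y)"
      using z by (intro infsum_cong_neutral) (auto simp: d_def)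
    then show ?thesis by simp
  qed
  define q where "q = (\<lambda>x. if x \<in> V then b z x / m x else 0)"
  have q: "q \<in> ell2 V m"
    unfolding ell2_def
  proof (intro CollectI conjI)
    show "(\<lambda>x. (q x)\<^sup>2 * m x) summable_on V"
      using b_sq_summable[OF z]
      by (rule summable_on_cong[THEN iffD1, rotated])
        (use m_pos in \<open>auto simp: q_def power2_eq_square\<close>)
  qed (simp add: q_def)
  have lap: "laplacian V b m d = (\<lambda>x. (infsum (b z) V / m z) * d x - q x)"
  proof
    fix x
    show "laplacian V b m d x = (infsum (b z) V / m z) * d x - q x"
    proof (cases "x \<in> V")
      case True
      then have "laplacian V b m d x = (d x * infsum (b x) V - b z x) / m x"
        using laplacian_eq[OF d True] bz b_sym[OF True z] by simp
      then show ?thesis using True by (simp add: d_def q_def diff_divide_distrib)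
    next
      case False
      then have "d x = 0" using z by (auto simp: d_def)
      then show ?thesis using False by (simp add: laplacian_outside q_def)
    qed
  qed
  show "laplacian V b m d \<in> ell2 V m"
    unfolding lap by (intro ell2_diff ell2_scale d q)
  assume g: "g \<in> ell2 V m"
  have "ell2_inner V m d g = (\<Sum>\<^sub>\<infinity>x\<in>{z}. g x * m x)"
    unfolding ell2_inner_def using z by (intro infsum_cong_neutral) (auto simp: d_def)
  then have dg: "ell2_inner V m d g = g z * m z" by simp
  have qg: "ell2_inner V m q g = (\<Sum>\<^sub>\<infinity>y\<in>V. b z y * g y)"
    unfolding ell2_inner_def using m_pos by (intro infsum_cong) (auto simp: q_def less_le)
  show "ell2_inner V m (laplacian V b m d) g = laplacian V b m g z * m z"
    unfolding lap using m_pos[OF z]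
    by (subst inner_diff_left[OF ell2_scale[OF d] q g])
      (simp only: inner_scale_left dg qg laplacian_eq[OF g z], simp)
qed

text \<open>Induction over a finite set that contains the support, splitting off a multiple of one
  point mass at a time.\<close>

lemma laplacian_supported_on_finite:
  assumes "finite F" "F \<subseteq> V" "\<And>x. x \<notin> F \<Longrightarrow> f x = 0"
  shows "f \<in> ell2 V m \<and> laplacian V b m f \<in> ell2 V m \<and> (\<forall>g\<in>ell2 V m.
    ell2_inner V m (laplacian V b m f) g = (\<Sum>x\<in>F. f x * laplacian V b m g x * m x))"
  using assms
proof (induction F arbitrary: f rule: finite_induct)
  case empty
  then have "f = (\<lambda>x. 0)" by auto
  then show ?case by (simp add: ell2_0 laplacian_def ell2_inner_def cong: if_cong)
next
  case (insert z F)
  define d where "d = (\<lambda>x. if x = z then 1 else 0 :: real)"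
  define f' where "f' = f(z := 0)"
  have z: "z \<in> V" using insert.prems(1) by simp
  note del = laplacian_delta[OF z, folded d_def]
  have f': "f' \<in> ell2 V m" "laplacian V b m f' \<in> ell2 V m" "\<And>g. g \<in> ell2 V m \<Longrightarrow>
    ell2_inner V m (laplacian V b m f') g = (\<Sum>x\<in>F. f' x * laplacian V b m g x * m x)"
  proof -
    have "F \<subseteq> V" "\<And>x. x \<notin> F \<Longrightarrow> f' x = 0" using insert.prems by (auto simp: f'_def)
    note * = insert.IH[of f', OF this]
    show "f' \<in> ell2 V m" "laplacian V b m f' \<in> ell2 V m" using * by blast+
    show "ell2_inner V m (laplacian V b m f') g = (\<Sum>x\<in>F. f' x * laplacian V b m g x * m x)"
      if "g \<in> ell2 V m" for g using * that by blast
  qed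
  have f: "f = (\<lambda>x. f' x + f z * d x)" by (auto simp: f'_def d_def)
  have fd: "(\<lambda>x. f z * d x) \<in> ell2 V m" by (rule ell2_scale[OF del(1)])
  have lap: "laplacian V b m f = (\<lambda>x. laplacian V b m f' x + f z * laplacian V b m d x)"
    by (subst f) (simp add: laplacian_add[OF f'(1) fd] laplacian_scale)
  have fe: "f \<in> ell2 V m" by (subst f) (rule ell2_add[OF f'(1) fd])
  have le: "laplacian V b m f \<in> ell2 V m"
    unfolding lap by (intro ell2_add ell2_scale f' del)
  have "ell2_inner V m (laplacian V b m f) g = (\<Sum>x\<in>insert z F. f x * laplacian V b m g x * m x)"
    if g: "g \<in> ell2 V m" for g
  proof -
    have "(\<Sum>x\<in>F. f' x * laplacian V b m g x * m x) = (\<Sum>x\<in>F. f x * laplacian V b m g x * m x)"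
      using insert.hyps by (intro sum.cong) (auto simp: f'_def)
    then show ?thesis
      unfolding lap using insert.hyps
      by (simp add: inner_add_left ell2_scale f' del g inner_scale_left)
  qed
  then show ?case using fe le by blast
qed

lemma finitely_supportedD:
  assumes f: "f \<in> finitely_supported V"
  shows "laplacian V b m f \<in> ell2 V m"
    and "g \<in> ell2 V m \<Longrightarrow>
      ell2_inner V m (laplacian V b m f) g = ell2_inner V m f (laplacian V b m g)"
proof -
  let ?F = "{x\<in>V. f x \<noteq> 0}"
  have F: "finite ?F" "?F \<subseteq> V" "\<And>x. x \<notin> ?F \<Longrightarrow> f x = 0"
    using f by (auto simp: finitely_supported_def)
  show "laplacian V b m f \<in> ell2 V m" using laplacian_supported_on_finite[of ?F f] F by blast
  assume "g \<in> ell2 V m"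
  then have "ell2_inner V m (laplacian V b m f) g = (\<Sum>x\<in>?F. f x * laplacian V b m g x * m x)"
    using laplacian_supported_on_finite[of ?F f] F by blast
  also have "\<dots> = (\<Sum>\<^sub>\<infinity>x\<in>?F. f x * laplacian V b m g x * m x)" using F(1) by simp
  also have "\<dots> = ell2_inner V m f (laplacian V b m g)"
    unfolding ell2_inner_def by (intro infsum_cong_neutral) auto
  finally show "ell2_inner V m (laplacian V b m f) g = ell2_inner V m f (laplacian V b m g)" .
qed

text \<open>Testing against point masses forces h to be the Laplacian of g at each vertex.
  Conversely, Green's formula holds as soon as one of the two functions has finite support.\<close>

lemma adjoint_L_c:
  "adjoint_operator V m (L_c V b m) =
     {(g, laplacian V b m g) | g. g \<in> ell2 V m \<and> laplacian V b m g \<in> ell2 V m}"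
proof (intro equalityI subrelI)
  fix g h assume "(g, h) \<in> adjoint_operator V m (L_c V b m)"
  then have gh: "g \<in> ell2 V m" "h \<in> ell2 V m" and adj: "\<And>f. f \<in> finitely_supported V \<Longrightarrow>
      ell2_inner V m (laplacian V b m f) g = ell2_inner V m f h"
    by (auto simp: mem_adjoint_iff L_c_def)
  have "h x = laplacian V b m g x" for x
  proof (cases "x \<in> V")
    case True
    define d where "d = (\<lambda>y. if y = x then 1 else 0 :: real)"
    have "d \<in> finitely_supported V" using True by (auto simp: d_def finitely_supported_def)
    then have "laplacian V b m g x * m x = ell2_inner V m d h"
      using laplacian_delta(3)[OF True gh(1)] adj[of d] by (simp add: d_def)
    also have "\<dots> = (\<Sum>\<^sub>\<infinity>y\<in>{x}. h y * m y)"
      unfolding ell2_inner_def using True by (intro infsum_cong_neutral) (auto simp: d_def)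
    finally show ?thesis using m_pos[OF True] by simp
  qed (simp add: laplacian_outside ell2_zero_outside[OF gh(2)])
  then have "h = laplacian V b m g" by auto
  then show "(g, h) \<in> {(g, laplacian V b m g) | g. g \<in> ell2 V m \<and> laplacian V b m g \<in> ell2 V m}"
    using gh by blast
next
  fix g h
  assume "(g, h) \<in> {(g, laplacian V b m g) | g. g \<in> ell2 V m \<and> laplacian V b m g \<in> ell2 V m}"
  then have "g \<in> ell2 V m" "h = laplacian V b m g" "h \<in> ell2 V m" by auto
  then show "(g, h) \<in> adjoint_operator V m (L_c V b m)"
    using finitely_supportedD(2) by (auto simp: mem_adjoint_iff L_c_def)
qed

lemma finitely_supported_add:
  "f \<in> finitely_supported V \<Longrightarrow> g \<in> finitely_supported V \<Longrightarrow> (\<lambda>x. f x + g x) \<in> finitely_supported V"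
proof -
  assume *: "f \<in> finitely_supported V" "g \<in> finitely_supported V"
  then have "finite ({x\<in>V. f x \<noteq> 0} \<union> {x\<in>V. g x \<noteq> 0})" by (simp add: finitely_supported_def)
  then have "finite {x\<in>V. f x + g x \<noteq> 0}" by (rule rev_finite_subset) auto
  then show ?thesis using * by (auto simp: finitely_supported_def)
qed

lemma finitely_supported_scale:
  "f \<in> finitely_supported V \<Longrightarrow> (\<lambda>x. c * f x) \<in> finitely_supported V"
  by (auto simp: finitely_supported_def elim!: rev_finite_subset)

lemma L_c_symmetric: "symmetric_operator (L_c V b m)"
proof
  have mem: "(f, h) \<in> L_c V b m \<longleftrightarrow> f \<in> finitely_supported V \<and> h = laplacian V b m f" for f h
    by (auto simp: L_c_def)
  show "ell2_operator V m (L_c V b m)"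
    unfolding ell2_operator_def
  proof (intro conjI allI impI)
    show "L_c V b m \<subseteq> ell2 V m \<times> ell2 V m"
      using finitely_supported_ell2 finitely_supportedD(1) by (auto simp: L_c_def)
    show "single_valued (L_c V b m)" by (auto simp: single_valued_def mem)
    show "(\<lambda>x. 0, \<lambda>x. 0) \<in> L_c V b m"
      by (auto simp: mem finitely_supported_def laplacian_def)
  next
    fix f h g k assume "(f, h) \<in> L_c V b m" "(g, k) \<in> L_c V b m"
    then show "(\<lambda>x. f x + g x, \<lambda>x. h x + k x) \<in> L_c V b m"
      by (auto simp: mem finitely_supported_add finitely_supported_ell2 laplacian_add)
  next
    fix c f h assume "(f, h) \<in> L_c V b m"
    then show "(\<lambda>x. c * f x, \<lambda>x. c * h x) \<in> L_c V b m"
      by (auto simp: mem finitely_supported_scale laplacian_scale)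
  qed
  show "L_c V b m \<subseteq> adjoint_operator V m (L_c V b m)"
    using finitely_supported_ell2 finitely_supportedD(1)
    unfolding adjoint_L_c by (auto simp: L_c_def)
qed

lemma L_c_densely_defined: "densely_defined V m (L_c V b m)"
  unfolding densely_defined_def
proof (intro ballI allI impI)
  fix g and e :: real assume g: "g \<in> ell2 V m" and e: "0 < e"
  note gs = ell2_summable[OF g]
  \<comment> \<open>The finite approximation is only within \<open>\<le>\<close>; halving leaves
    room for the strict inequality.\<close>
  have "e\<^sup>2 / 2 > 0" using e by simp
  then obtain F where F: "finite F" "F \<subseteq> V"
      "dist (\<Sum>x\<in>F. (g x)\<^sup>2 * m x) (\<Sum>\<^sub>\<infinity>x\<in>V. (g x)\<^sup>2 * m x) \<le> e\<^sup>2 / 2"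
    using infsum_finite_approximation[OF gs] by blast
  define f where "f = (\<lambda>x. if x \<in> F then g x else 0)"
  have f: "f \<in> finitely_supported V"
    using F by (auto simp: f_def finitely_supported_def elim!: rev_finite_subset)
  have "ell2_inner V m (\<lambda>x. g x - f x) (\<lambda>x. g x - f x) = (\<Sum>\<^sub>\<infinity>x\<in>V - F. (g x)\<^sup>2 * m x)"
    unfolding ell2_inner_def by (intro infsum_cong_neutral) (auto simp: f_def power2_eq_square)
  also have "\<dots> = (\<Sum>\<^sub>\<infinity>x\<in>V. (g x)\<^sup>2 * m x) - (\<Sum>x\<in>F. (g x)\<^sup>2 * m x)"
    using infsum_Diff[OF gs summable_on_finite[OF F(1)] F(2)] F(1) by simp
  also have "\<dots> \<le> e\<^sup>2 / 2" using F(3) unfolding dist_real_def by linarith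
  also have "\<dots> < e\<^sup>2" using e by simp
  finally have "ell2_norm V m (\<lambda>x. g x - f x) < sqrt (e\<^sup>2)"
    unfolding ell2_norm_def by (rule real_sqrt_less_mono)
  then have "ell2_norm V m (\<lambda>x. g x - f x) < e" using e by simp
  moreover have "f \<in> Domain (L_c V b m)" using f by (auto simp: L_c_def)
  ultimately show "\<exists>f\<in>Domain (L_c V b m). ell2_norm V m (\<lambda>x. g x - f x) < e" by blast
qed

theorem essentially_self_adjoint_iff_max_symmetric:
  "essentially_self_adjoint V m (L_c V b m) \<longleftrightarrow> max_symmetric V b m"
  unfolding essentially_self_adjoint_iff_adjoint_symmetric[OF L_c_symmetric L_c_densely_defined]
  by (force simp: adjoint_L_c mem_adjoint_iff max_symmetric_def)

end

section \<open>Graphs partitioned with bounded degree between the parts\<close>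

text \<open>Expand the nonnegative sum of c (a - t)^2 at t = B / K. Dividing by the bound K rather
  than by the total weight avoids a separate case for total weight 0.\<close>

lemma infsum_weighted_Cauchy_Schwarz:
  fixes c a :: "'a \<Rightarrow> real"
  assumes c: "\<And>y. y \<in> A \<Longrightarrow> 0 \<le> c y" "c summable_on A" "infsum c A \<le> K" "0 < K"
    and ca: "(\<lambda>y. c y * a y) summable_on A" and ca2: "(\<lambda>y. c y * (a y)\<^sup>2) summable_on A"
  shows "(\<Sum>\<^sub>\<infinity>y\<in>A. c y * a y)\<^sup>2 \<le> K * (\<Sum>\<^sub>\<infinity>y\<in>A. c y * (a y)\<^sup>2)"
proof -
  define B D t where "B = (\<Sum>\<^sub>\<infinity>y\<in>A. c y * a y)" and "D = (\<Sum>\<^sub>\<infinity>y\<in>A. c y * (a y)\<^sup>2)" and "t = B / K"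
  have "0 \<le> (\<Sum>\<^sub>\<infinity>y\<in>A. c y * (a y - t)\<^sup>2)"
    using c(1) by (intro infsum_nonneg) simp
  also have "(\<Sum>\<^sub>\<infinity>y\<in>A. c y * (a y - t)\<^sup>2) =
      (\<Sum>\<^sub>\<infinity>y\<in>A. (c y * (a y)\<^sup>2 - (2 * t) * (c y * a y)) + t\<^sup>2 * c y)"
    by (intro infsum_cong) (simp add: power2_eq_square algebra_simps)
  also have "\<dots> = (D - 2 * t * B) + t\<^sup>2 * infsum c A"
    by (subst infsum_add)
      (simp_all add: summable_on_diff_real ca ca2 summable_on_cmult_right c(2) infsum_diff_real
        infsum_cmult_right' B_def D_def)
  also have "\<dots> \<le> (D - 2 * t * B) + t\<^sup>2 * K"
    using c(3) by (intro add_left_mono mult_left_mono) auto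
  finally have "0 \<le> D - B\<^sup>2 / K"
    using c(4) by (simp add: t_def power2_eq_square field_simps)
  then show ?thesis using c(4) by (simp add: B_def D_def field_simps)
qed

text \<open>Edge weights of degree at most C: their Laplacian is an everywhere defined bounded
  symmetric operator. The edges cut by a partition will be an instance.\<close>

locale bounded_weights = ell2_space V m
  for V :: "'a set" and m :: "'a \<Rightarrow> real" +
  fixes c :: "'a \<Rightarrow> 'a \<Rightarrow> real" and C :: real
  assumes c_nonneg: "x \<in> V \<Longrightarrow> y \<in> V \<Longrightarrow> 0 \<le> c x y"
    and c_sym: "x \<in> V \<Longrightarrow> y \<in> V \<Longrightarrow> c x y = c y x"
    and c_summable: "x \<in> V \<Longrightarrow> c x summable_on V"
    and c_bound: "x \<in> V \<Longrightarrow> infsum (c x) V \<le> C * m x"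
    and C_pos: "0 < C"
begin

lemma summable_c_sq_fst:
  assumes f: "f \<in> ell2 V m"
  shows "(\<lambda>(x, y). c x y * (f x)\<^sup>2) summable_on V \<times> V"
proof (rule summable_on_SigmaI)
  fix x assume x: "x \<in> V"
  show "((\<lambda>y. case (x, y) of (x, y) \<Rightarrow> c x y * (f x)\<^sup>2) has_sum infsum (c x) V * (f x)\<^sup>2) V"
    using has_sum_cmult_left[OF has_sum_infsum[OF c_summable[OF x]]] by simp
next
  show "(\<lambda>x. infsum (c x) V * (f x)\<^sup>2) summable_on V"
  proof (rule summable_on_comparison_test)
    show "(\<lambda>x. C * ((f x)\<^sup>2 * m x)) summable_on V"
      using ell2_summable[OF f] by (rule summable_on_cmult_right)
    show "infsum (c x) V * (f x)\<^sup>2 \<le> C * ((f x)\<^sup>2 * m x)" if "x \<in> V" for x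
      using mult_right_mono[OF c_bound[OF that], of "(f x)\<^sup>2"] by (simp add: ac_simps)
  qed (auto intro!: mult_nonneg_nonneg infsum_nonneg c_nonneg)
qed (simp add: c_nonneg)

lemma summable_c_sq_snd:
  assumes f: "f \<in> ell2 V m"
  shows "(\<lambda>(x, y). c x y * (f y)\<^sup>2) summable_on V \<times> V"
proof -
  have "(\<lambda>(x, y). (\<lambda>(x, y). c x y * (f x)\<^sup>2) (y, x)) summable_on V \<times> V"
    using summable_c_sq_fst[OF f] by (subst (asm) summable_on_swap) (simp add: case_prod_unfold)
  then show ?thesis
    by (rule summable_on_cong[THEN iffD1, rotated]) (auto simp: c_sym)
qed

text \<open>One majorant for all double sums below: it covers squared differences as well as
  products of values of f and g at the ends of an edge.\<close>

lemma summable_c_bounded: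
  assumes f: "f \<in> ell2 V m" and g: "g \<in> ell2 V m"
    and h: "\<And>x y. \<bar>h x y\<bar> \<le> 2 * ((f x)\<^sup>2 + (f y)\<^sup>2 + (g x)\<^sup>2 + (g y)\<^sup>2)"
  shows "(\<lambda>(x, y). c x y * h x y) summable_on V \<times> V"
proof (rule real_abs_summable(1))
  let ?G = "\<lambda>p. 2 * (((case p of (x, y) \<Rightarrow> c x y * (f x)\<^sup>2) + (case p of (x, y) \<Rightarrow> c x y * (f y)\<^sup>2)) +
      ((case p of (x, y) \<Rightarrow> c x y * (g x)\<^sup>2) + (case p of (x, y) \<Rightarrow> c x y * (g y)\<^sup>2)))"
  show "?G summable_on V \<times> V"
    by (intro summable_on_cmult_right summable_on_add summable_c_sq_fst summable_c_sq_snd f g)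
  fix p assume "p \<in> V \<times> V"
  then obtain x y where p: "p = (x, y)" "x \<in> V" "y \<in> V" by auto
  show "\<bar>case p of (x, y) \<Rightarrow> c x y * h x y\<bar> \<le> ?G p"
    using mult_left_mono[OF h[of x y] c_nonneg[OF p(2,3)]] c_nonneg[OF p(2,3)]
    by (simp add: p abs_mult algebra_simps)
qed

text \<open>Weighted Cauchy-Schwarz bounds the squared sum at x by C m(x) times the energy at x;
  dividing by m(x) leaves C times the total energy, finite by the degree bound. Summability of the
  first differences comes from |t| \<le> 1 + t^2.\<close>

lemma
  assumes f: "f \<in> ell2 V m"
  shows summable_c_diff: "x \<in> V \<Longrightarrow> (\<lambda>y. c x y * (f x - f y)) summable_on V"
    and laplacian_bounded_ell2: "laplacian V c m f \<in> ell2 V m"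
proof -
  have sq: "(\<lambda>(x, y). c x y * (f x - f y)\<^sup>2) summable_on V \<times> V"
    by (rule summable_c_bounded[OF f ell2_0]) (use square_diff_bound in auto)
  have sqx: "(\<lambda>y. c x y * (f x - f y)\<^sup>2) summable_on V" if "x \<in> V" for x
    using summable_on_SigmaD1[OF sq that] by simp
  have lin: "(\<lambda>y. c x y * (f x - f y)) summable_on V" if x: "x \<in> V" for x
  proof (rule real_abs_summable(1))
    show "(\<lambda>y. c x y + c x y * (f x - f y)\<^sup>2) summable_on V"
      by (intro summable_on_add c_summable sqx x)
    fix y assume y: "y \<in> V"
    have "\<bar>f x - f y\<bar> \<le> 1 + (f x - f y)\<^sup>2"
      by (rule abs_le_one_plus_square)
    then show "\<bar>c x y * (f x - f y)\<bar> \<le> c x y + c x y * (f x - f y)\<^sup>2"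
      using mult_left_mono[OF _ c_nonneg[OF x y]] c_nonneg[OF x y]
      by (fastforce simp: abs_mult distrib_left)
  qed
  then show "x \<in> V \<Longrightarrow> (\<lambda>y. c x y * (f x - f y)) summable_on V" by simp
  show "laplacian V c m f \<in> ell2 V m"
    unfolding ell2_def
  proof (intro CollectI conjI)
    show "(\<lambda>x. (laplacian V c m f x)\<^sup>2 * m x) summable_on V"
    proof (rule summable_on_comparison_test)
      show "(\<lambda>x. C * (\<Sum>\<^sub>\<infinity>y\<in>V. c x y * (f x - f y)\<^sup>2)) summable_on V"
        using summable_on_Sigma_banach[OF sq] by (intro summable_on_cmult_right) simp
      show "(laplacian V c m f x)\<^sup>2 * m x \<le> C * (\<Sum>\<^sub>\<infinity>y\<in>V. c x y * (f x - f y)\<^sup>2)"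
        if x: "x \<in> V" for x
      proof -
        have "(\<Sum>\<^sub>\<infinity>y\<in>V. c x y * (f x - f y))\<^sup>2 \<le> (C * m x) * (\<Sum>\<^sub>\<infinity>y\<in>V. c x y * (f x - f y)\<^sup>2)"
          using x C_pos m_pos[OF x]
          by (intro infsum_weighted_Cauchy_Schwarz c_nonneg c_summable c_bound lin sqx) auto
        then show ?thesis
          using x m_pos[OF x] by (simp add: laplacian_def power2_eq_square field_simps)
      qed
      show "0 \<le> (laplacian V c m f x)\<^sup>2 * m x" if "x \<in> V" for x
        using m_pos[OF that] by simp
    qed
  qed (simp add: laplacian_def)
qed

text \<open>Both pairings are differences of absolutely convergent double sums: the sum of c f(x)
  g(x) is symmetric in f and g, and in the sum of c f(y) g(x) the roles of x and y are
  exchanged.\<close>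

lemma laplacian_bounded_symmetric:
  assumes f: "f \<in> ell2 V m" and g: "g \<in> ell2 V m"
  shows "ell2_inner V m (laplacian V c m f) g = ell2_inner V m f (laplacian V c m g)"
proof -
  have expand: "ell2_inner V m (laplacian V c m f) g =
      (\<Sum>\<^sub>\<infinity>(x,y)\<in>V\<times>V. c x y * (f x * g x)) - (\<Sum>\<^sub>\<infinity>(x,y)\<in>V\<times>V. c x y * (f y * g x))"
    if f: "f \<in> ell2 V m" and g: "g \<in> ell2 V m" for f g
  proof -
    have b: "\<bar>f x * g y\<bar> \<le> 2 * ((f x)\<^sup>2 + (f z)\<^sup>2 + (g w)\<^sup>2 + (g y)\<^sup>2)" for x y z w
      using two_mult_le_squares[of "f x" "g y"] abs_ge_zero[of "f x * g y"]
        zero_le_power2[of "f z"] zero_le_power2[of "g w"] unfolding distrib_left by linarith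
    have s1: "(\<lambda>(x,y). c x y * (f x * g x)) summable_on V\<times>V"
    proof (intro summable_c_bounded[OF f g])
      show "\<bar>f x * g x\<bar> \<le> 2 * ((f x)\<^sup>2 + (f y)\<^sup>2 + (g x)\<^sup>2 + (g y)\<^sup>2)" for x y
        using b[of x x y y] by (simp add: ac_simps)
    qed
    have s2: "(\<lambda>(x,y). c x y * (f y * g x)) summable_on V\<times>V"
    proof (intro summable_c_bounded[OF f g])
      show "\<bar>f y * g x\<bar> \<le> 2 * ((f x)\<^sup>2 + (f y)\<^sup>2 + (g x)\<^sup>2 + (g y)\<^sup>2)" for x y
        using b[of y x x y] by (simp add: ac_simps)
    qed
    have s3: "(\<lambda>(x,y). c x y * (f x * g x) - c x y * (f y * g x)) summable_on V\<times>V"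
      using summable_on_diff_real[OF s1 s2] by (simp add: case_prod_unfold)
    have "ell2_inner V m (laplacian V c m f) g =
        (\<Sum>\<^sub>\<infinity>x\<in>V. \<Sum>\<^sub>\<infinity>y\<in>V. c x y * (f x * g x) - c x y * (f y * g x))"
      unfolding ell2_inner_def
    proof (intro infsum_cong)
      fix x assume x: "x \<in> V"
      have "laplacian V c m f x * g x * m x = (\<Sum>\<^sub>\<infinity>y\<in>V. c x y * (f x - f y)) * g x"
        using x m_pos[OF x] by (simp add: laplacian_def)
      also have "\<dots> = (\<Sum>\<^sub>\<infinity>y\<in>V. c x y * (f x * g x) - c x y * (f y * g x))"
        by (subst infsum_cmult_left'[symmetric], intro infsum_cong) (simp add: algebra_simps)
      finally show "laplacian V c m f x * g x * m x = \<dots>" .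
    qed
    also have "\<dots> = (\<Sum>\<^sub>\<infinity>(x,y)\<in>V\<times>V. c x y * (f x * g x) - c x y * (f y * g x))"
      using infsum_Sigma'_banach[OF s3] by simp
    also have "\<dots> = (\<Sum>\<^sub>\<infinity>(x,y)\<in>V\<times>V. c x y * (f x * g x)) - (\<Sum>\<^sub>\<infinity>(x,y)\<in>V\<times>V. c x y * (f y * g x))"
      using infsum_diff_real[OF s1 s2] by (simp add: case_prod_unfold)
    finally show ?thesis .
  qed
  have "(\<Sum>\<^sub>\<infinity>(x,y)\<in>V\<times>V. c x y * (f y * g x)) = (\<Sum>\<^sub>\<infinity>(x,y)\<in>V\<times>V. c x y * (g y * f x))"
    by (rule infsum_reindex_bij_witness[of _ prod.swap prod.swap]) (auto simp: c_sym ac_simps)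
  then show ?thesis
    using expand[OF f g] expand[OF g f] inner_commute[of f]
    by (simp add: mult.commute[of "g _" "f _"])
qed

end

section \<open>Cutting a graph along a partition\<close>

locale partitioned_graph = graph_weights X m b
  for X :: "'a set" and m :: "'a \<Rightarrow> real" and b :: "'a \<Rightarrow> 'a \<Rightarrow> real" +
  fixes p :: "'a \<Rightarrow> 'j" and C :: real
  assumes cut_bound: "x \<in> X \<Longrightarrow> (\<Sum>\<^sub>\<infinity>y\<in>{y\<in>X. p y \<noteq> p x}. b x y) \<le> C * m x"
    and cut_pos: "0 < C"
begin

definition "b_across x y = (if p y \<noteq> p x then b x y else 0)"
definition "b_within x y = (if p y = p x then b x y else 0)"
text \<open>Every label has a fibre; it is empty if \<open>p\<close> does not attain the label on
  \<open>X\<close>. This allows quantifying over all labels.\<close>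

definition "fibre j = {x\<in>X. p x = j}"

lemma fibre_subset: "fibre j \<subseteq> X" by (auto simp: fibre_def)

lemma infsum_b_across: "infsum (b_across x) X = (\<Sum>\<^sub>\<infinity>y\<in>{y\<in>X. p y \<noteq> p x}. b x y)"
  by (intro infsum_cong_neutral) (auto simp: b_across_def)

lemma bounded_weights_b_across: "bounded_weights X m b_across C"
proof
  fix x assume x: "x \<in> X"
  show "b_across x summable_on X"
    using b_summable[OF x] by (rule summable_on_comparison_test) (use x b_nonneg in \<open>auto simp: b_across_def\<close>)
  show "infsum (b_across x) X \<le> C * m x" using cut_bound[OF x] by (simp add: infsum_b_across)
qed (use b_nonneg b_sym cut_pos in \<open>auto simp: b_across_def\<close>)

interpretation across: bounded_weights X m b_across C by (rule bounded_weights_b_across)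

lemma laplacian_split:
  assumes f: "f \<in> ell2 X m"
  shows "laplacian X b m f = (\<lambda>x. laplacian X b_within m f x + laplacian X b_across m f x)"
proof
  fix x
  show "laplacian X b m f x = laplacian X b_within m f x + laplacian X b_across m f x"
  proof (cases "x \<in> X")
    case x: True
    have sb: "(\<lambda>y. b x y * (f x - f y)) summable_on X"
      using summable_on_diff_real[OF summable_on_cmult_left[OF b_summable[OF x]] b_mult_summable[OF f x]]
      by (simp add: right_diff_distrib)
    have sc: "(\<lambda>y. b_across x y * (f x - f y)) summable_on X" by (rule across.summable_c_diff[OF f x])
    have "(\<Sum>\<^sub>\<infinity>y\<in>X. b_within x y * (f x - f y)) = (\<Sum>\<^sub>\<infinity>y\<in>X. b x y * (f x - f y) - b_across x y * (f x - f y))"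
      by (intro infsum_cong) (simp add: b_across_def b_within_def)
    also have "\<dots> = (\<Sum>\<^sub>\<infinity>y\<in>X. b x y * (f x - f y)) - (\<Sum>\<^sub>\<infinity>y\<in>X. b_across x y * (f x - f y))"
      by (rule infsum_diff_real[OF sb sc])
    finally show ?thesis using x by (simp add: laplacian_def diff_divide_distrib)
  qed (simp add: laplacian_def)
qed

text \<open>The cut edges map \<open>ell2\<close> into itself, so both Laplacians have the same
  maximal domain, and the symmetric contribution of the cut edges cancels.\<close>

lemma max_symmetric_b_within: "max_symmetric X b m \<longleftrightarrow> max_symmetric X b_within m"
proof -
  have mem: "laplacian X b m f \<in> ell2 X m \<longleftrightarrow> laplacian X b_within m f \<in> ell2 X m"
    if f: "f \<in> ell2 X m" for f
  proof
    assume "laplacian X b m f \<in> ell2 X m"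
    from ell2_diff[OF this across.laplacian_bounded_ell2[OF f]]
    show "laplacian X b_within m f \<in> ell2 X m" by (simp add: laplacian_split[OF f])
  next
    assume "laplacian X b_within m f \<in> ell2 X m"
    from ell2_add[OF this across.laplacian_bounded_ell2[OF f]]
    show "laplacian X b m f \<in> ell2 X m" by (simp add: laplacian_split[OF f])
  qed
  have "ell2_inner X m (laplacian X b m f) g = ell2_inner X m f (laplacian X b m g) \<longleftrightarrow>
      ell2_inner X m (laplacian X b_within m f) g = ell2_inner X m f (laplacian X b_within m g)"
    if "f \<in> ell2 X m" "g \<in> ell2 X m"
      "laplacian X b_within m f \<in> ell2 X m" "laplacian X b_within m g \<in> ell2 X m" for f g
    using that across.laplacian_bounded_symmetric[OF that(1,2)]
    by (simp add: laplacian_split inner_add_left inner_add_right across.laplacian_bounded_ell2)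
  then show ?thesis using mem unfolding max_symmetric_def by blast
qed

abbreviation "on_fibre j f \<equiv> (\<lambda>x. if x \<in> fibre j then f x else 0)"

lemma on_fibre_ell2: "f \<in> ell2 X m \<Longrightarrow> on_fibre j f \<in> ell2 (fibre j) m"
  by (auto simp: ell2_def intro: summable_on_subset_banach[OF _ fibre_subset] cong: summable_on_cong)

lemma ell2_fibre_subset:
  assumes f: "f \<in> ell2 (fibre j) m" shows "f \<in> ell2 X m"
proof -
  have "(\<lambda>x. (f x)\<^sup>2 * m x) summable_on X \<longleftrightarrow> (\<lambda>x. (f x)\<^sup>2 * m x) summable_on fibre j"
    using f fibre_subset by (intro summable_on_cong_neutral) (auto simp: ell2_def)
  then show ?thesis using f fibre_subset by (auto simp: ell2_def)
qed

lemma inner_fibre: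
  assumes "f \<in> ell2 (fibre j) m"
  shows "ell2_inner X m f g = ell2_inner (fibre j) m f g"
  unfolding ell2_inner_def using assms fibre_subset
  by (intro infsum_cong_neutral) (auto simp: ell2_def)

lemma laplacian_on_fibre:
  "laplacian (fibre j) b m (on_fibre j f) = on_fibre j (laplacian X b_within m f)"
proof
  fix x
  show "laplacian (fibre j) b m (on_fibre j f) x = on_fibre j (laplacian X b_within m f) x"
  proof (cases "x \<in> fibre j")
    case True
    have "(\<Sum>\<^sub>\<infinity>y\<in>fibre j. b x y * (f x - on_fibre j f y)) = (\<Sum>\<^sub>\<infinity>y\<in>X. b_within x y * (f x - f y))"
      using True by (intro infsum_cong_neutral) (auto simp: fibre_def b_within_def)
    then show ?thesis using True fibre_subset by (auto simp: laplacian_def)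
  qed (simp add: laplacian_def)
qed

lemma laplacian_fibre:
  assumes f: "f \<in> ell2 (fibre j) m"
  shows "laplacian X b_within m f = laplacian (fibre j) b m f"
proof
  fix x
  have f0: "f y = 0" if "y \<notin> fibre j" for y using f that by (auto simp: ell2_def)
  then have fp: "on_fibre j f = f" by auto
  show "laplacian X b_within m f x = laplacian (fibre j) b m f x"
  proof (cases "x \<in> fibre j")
    case True
    then show ?thesis using laplacian_on_fibre[of j f] fp by simp
  next
    case False
    have "(\<Sum>\<^sub>\<infinity>y\<in>X. b_within x y * (f x - f y)) = 0" if "x \<in> X"
      using False f0 that by (intro infsum_0) (auto simp: b_within_def fibre_def)
    then show ?thesis using False by (simp add: laplacian_def)
  qed
qed

lemma infsum_fibres:
  fixes h :: "'a \<Rightarrow> real"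
  assumes "h summable_on X"
  shows "infsum h X = (\<Sum>\<^sub>\<infinity>j\<in>p ` X. infsum h (fibre j))"
proof -
  have bij: "bij_betw snd (Sigma (p ` X) fibre) X"
    by (rule bij_betwI[of _ _ _ "\<lambda>x. (p x, x)"]) (auto simp: fibre_def)
  have "(\<lambda>q. h (snd q)) summable_on Sigma (p ` X) fibre"
    using summable_on_reindex_bij_betw[OF bij] assms by blast
  from infsum_Sigma_banach[OF this] show ?thesis
    using infsum_reindex_bij_betw[OF bij, of h] by simp
qed

text \<open>Downwards, functions on a fibre are extended by zero, and \<open>b_within\<close> does
  not see other fibres. Upwards, the inner products converge absolutely and are summed fibre by
  fibre.\<close>

theorem max_symmetric_iff_fibres:
  "max_symmetric X b m \<longleftrightarrow> (\<forall>j. max_symmetric (fibre j) b m)"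
  unfolding max_symmetric_b_within
proof (intro iffI allI)
  fix j assume sym: "max_symmetric X b_within m"
  show "max_symmetric (fibre j) b m"
    unfolding max_symmetric_def
  proof (intro ballI impI)
    fix f g assume fg: "f \<in> ell2 (fibre j) m" "g \<in> ell2 (fibre j) m"
      "laplacian (fibre j) b m f \<in> ell2 (fibre j) m" "laplacian (fibre j) b m g \<in> ell2 (fibre j) m"
    then have "ell2_inner X m (laplacian X b_within m f) g = ell2_inner X m f (laplacian X b_within m g)"
      using sym[unfolded max_symmetric_def, rule_format, of f g]
      by (simp add: ell2_fibre_subset laplacian_fibre)
    then show "ell2_inner (fibre j) m (laplacian (fibre j) b m f) g =
        ell2_inner (fibre j) m f (laplacian (fibre j) b m g)"
      using fg by (simp add: laplacian_fibre inner_fibre)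
  qed
next
  assume sym: "\<forall>j. max_symmetric (fibre j) b m"
  show "max_symmetric X b_within m"
    unfolding max_symmetric_def
  proof (intro ballI impI)
    fix f g assume fg: "f \<in> ell2 X m" "g \<in> ell2 X m"
      "laplacian X b_within m f \<in> ell2 X m" "laplacian X b_within m g \<in> ell2 X m"
    have parts: "ell2_inner X m u w = (\<Sum>\<^sub>\<infinity>j\<in>p ` X. ell2_inner (fibre j) m (on_fibre j u) (on_fibre j w))"
      if "u \<in> ell2 X m" "w \<in> ell2 X m" for u w
      using infsum_fibres[OF ell2_mult_summable[OF that]]
      unfolding ell2_inner_def by (simp cong: infsum_cong)
    have "ell2_inner (fibre j) m (on_fibre j (laplacian X b_within m f)) (on_fibre j g) =
        ell2_inner (fibre j) m (on_fibre j f) (on_fibre j (laplacian X b_within m g))" for j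
      using sym[rule_format, of j, unfolded max_symmetric_def, rule_format,
          of "on_fibre j f" "on_fibre j g"] fg on_fibre_ell2[of _ j]
      by (simp add: laplacian_on_fibre)
    then show "ell2_inner X m (laplacian X b_within m f) g = ell2_inner X m f (laplacian X b_within m g)"
      by (simp only: parts fg)
  qed
qed

end

section \<open>Hamburger's criterion for birth-death chains\<close>

lemma infsum_nat_partial_sums:
  fixes h :: "nat \<Rightarrow> real"
  assumes "h summable_on UNIV"
  shows "(\<lambda>n. \<Sum>x\<le>n. h x) \<longlonglongrightarrow> (\<Sum>\<^sub>\<infinity>x. h x)"
  using has_sum_imp_sums[OF has_sum_infsum[OF assms]] by (simp add: sums_def_le)

lemma nonneg_not_summable_at_top:
  fixes a :: "nat \<Rightarrow> real"
  assumes a: "\<And>x. 0 \<le> a x" and ns: "\<not> summable a"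
  shows "filterlim (\<lambda>n. \<Sum>x\<le>n. a x) at_top sequentially"
  unfolding filterlim_at_top
proof
  fix Z
  have mono: "(\<Sum>x\<le>n. a x) \<le> (\<Sum>x\<le>k. a x)" if "n \<le> k" for n k
    using that by (intro sum_mono2) (auto simp: a)
  have "\<exists>n. Z \<le> (\<Sum>x\<le>n. a x)"
  proof (rule ccontr)
    assume "\<not> ?thesis"
    then have "(\<Sum>x\<le>n. a x) \<le> Z" for n by (meson linear)
    then have "summable a" by (intro bounded_imp_summable[OF a])
    with ns show False by blast
  qed
  then show "eventually (\<lambda>n. Z \<le> (\<Sum>x\<le>n. a x)) sequentially"
    unfolding eventually_sequentially using mono by (meson order_trans)
qed

text \<open>The Pluecker relation for the vectors (f, f'), (g, g') and (q, p), where the primed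
  letters and \<open>p\<close> stand for values at n + 1: the Wronskian of two functions is
  recovered from their Wronskians with a third.\<close>

lemma Wronskian_identity:
  fixes p :: real
  assumes "p \<noteq> 0"
  shows "c * (f * g' - f' * g) =
    g' / p * (c * (f * p - f' * q)) - f' / p * (c * (g * p - g' * q))"
proof -
  have "g' / p * (c * (f * p - f' * q)) = c * (f * g' - f' * (g' * q / p))"
    "f' / p * (c * (g * p - g' * q)) = c * (f' * g - f' * (g' * q / p))"
    using assms by (simp_all add: right_diff_distrib)
  then show ?thesis by (simp add: right_diff_distrib)
qed

section \<open>Explicit formulas on a birth-death chain\<close>

locale birth_death =
  fixes b :: "nat \<Rightarrow> nat \<Rightarrow> real" and m :: "nat \<Rightarrow> real"
  assumes chain: "birth_death_chain b m"
begin

sublocale ell2_space UNIV m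
  using chain by unfold_locales (simp add: birth_death_chain_def weighted_graph_def)

definition "\<beta> k = b k (Suc k)"
definition "s x = (\<Sum>k<x. 1 / \<beta> k)"

abbreviation "Lap \<equiv> laplacian UNIV b m"

lemma m_gt_0: "0 < m x" using m_pos by simp

lemma \<beta>_pos: "0 < \<beta> k"
  using chain by (simp add: birth_death_chain_def \<beta>_def)

lemma b_Suc: "b (Suc k) k = \<beta> k" "b k (Suc k) = \<beta> k"
  using chain by (simp_all add: birth_death_chain_def weighted_graph_def \<beta>_def)

lemma b_zero: "\<bar>int x - int y\<bar> \<noteq> 1 \<Longrightarrow> b x y = 0"
  using chain unfolding birth_death_chain_def weighted_graph_def
  by (metis UNIV_I less_le)

lemma s_0: "s 0 = 0" and s_Suc: "s (Suc x) = s x + 1 / \<beta> x"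
  by (simp_all add: s_def)

lemma s_nonneg: "0 \<le> s x"
  unfolding s_def by (intro sum_nonneg) (simp add: less_imp_le \<beta>_pos)

lemma s_mono: "x \<le> y \<Longrightarrow> s x \<le> s y"
  unfolding s_def using \<beta>_pos by (intro sum_mono2) (auto simp: less_imp_le)

lemma Lap_0: "m 0 * Lap f 0 = \<beta> 0 * (f 0 - f 1)"
proof -
  have "(\<Sum>\<^sub>\<infinity>y. b 0 y * (f 0 - f y)) = (\<Sum>\<^sub>\<infinity>y\<in>{1}. b 0 y * (f 0 - f y))"
    by (intro infsum_cong_neutral) (auto intro!: b_zero)
  then show ?thesis using m_gt_0[of 0] by (simp add: laplacian_def b_Suc)
qed

lemma Lap_Suc:
  "m (Suc k) * Lap f (Suc k) =
     \<beta> (Suc k) * (f (Suc k) - f (Suc (Suc k))) + \<beta> k * (f (Suc k) - f k)"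
proof -
  have "(\<Sum>\<^sub>\<infinity>y. b (Suc k) y * (f (Suc k) - f y)) =
      (\<Sum>\<^sub>\<infinity>y\<in>{k, Suc (Suc k)}. b (Suc k) y * (f (Suc k) - f y))"
    by (intro infsum_cong_neutral) (auto intro!: b_zero)
  then show ?thesis using m_gt_0[of "Suc k"] by (simp add: laplacian_def b_Suc)
qed

text \<open>Only the edge from n to n + 1 leaves {0..n}; the contributions of all inner edges
  cancel.\<close>

lemma sum_Lap: "(\<Sum>x\<le>n. m x * Lap f x) = \<beta> n * (f n - f (Suc n))"
  by (induction n) (simp_all add: Lap_0 Lap_Suc algebra_simps)

lemma Green_chain:
  "(\<Sum>x\<le>n. m x * Lap f x * g x) - (\<Sum>x\<le>n. m x * Lap g x * f x) =
     \<beta> n * (f n * g (Suc n) - f (Suc n) * g n)"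
  by (induction n) (simp_all add: Lap_0 Lap_Suc algebra_simps)

lemma energy_chain:
  "(\<Sum>x\<le>n. m x * Lap f x * f x) =
     (\<Sum>k<n. \<beta> k * (f (Suc k) - f k)\<^sup>2) + \<beta> n * (f n - f (Suc n)) * f n"
  by (induction n) (simp_all add: Lap_0 Lap_Suc power2_eq_square algebra_simps)

text \<open>Partial sums determine their terms, so a Laplacian can be checked through the flux over
  single edges. All explicit Laplacians below are found this way.\<close>

lemma Lap_eqI:
  assumes "\<And>n. (\<Sum>x\<le>n. m x * h x) = \<beta> n * (f n - f (Suc n))"
  shows "Lap f = h"
proof
  fix x
  have eq: "(\<Sum>x\<le>n. m x * Lap f x) = (\<Sum>x\<le>n. m x * h x)" for n
    by (simp only: sum_Lap assms)
  have "m x * Lap f x = m x * h x"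
  proof (cases x)
    case 0
    then show ?thesis using eq[of 0] by simp
  next
    case (Suc k)
    then show ?thesis using eq[of k] eq[of "Suc k"] by simp
  qed
  then show "Lap f x = h x" using m_gt_0[of x] by simp
qed

lemma Lap_const: "Lap (\<lambda>x. c) = (\<lambda>x. 0)"
  by (rule Lap_eqI) simp

text \<open>\<open>s\<close> carries unit flux over every edge, so only the origin, where the flux
  starts, has a nonzero Laplacian.\<close>

lemma Lap_s: "Lap s = (\<lambda>x. if x = 0 then - 1 / m 0 else 0)"
proof (rule Lap_eqI)
  fix n
  have "(\<Sum>x\<le>n. m x * (if x = 0 then - 1 / m 0 else 0)) = (\<Sum>x\<in>{0::nat}. - 1)"
    using m_gt_0[of 0] by (intro sum.mono_neutral_cong_right) auto
  then show "(\<Sum>x\<le>n. m x * (if x = 0 then - 1 / m 0 else 0)) = \<beta> n * (s n - s (Suc n))"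
    using \<beta>_pos[of n] by (simp add: s_Suc)
qed

lemma ell2_iff: "f \<in> ell2 UNIV m \<longleftrightarrow> summable (\<lambda>x. (f x)\<^sup>2 * m x)"
  unfolding ell2_def using m_gt_0
  by (simp add: summable_on_UNIV_nonneg_real_iff less_imp_le)

lemma inner_partial_sums:
  assumes "f \<in> ell2 UNIV m" "g \<in> ell2 UNIV m"
  shows "(\<lambda>n. \<Sum>x\<le>n. f x * g x * m x) \<longlonglongrightarrow> ell2_inner UNIV m f g"
  unfolding ell2_inner_def by (intro infsum_nat_partial_sums ell2_mult_summable assms)

lemma finite_support_ell2: "finite {x. f x \<noteq> 0} \<Longrightarrow> f \<in> ell2 UNIV m"
  unfolding ell2_iff
  by (rule summable_finite[where N = "{x. f x \<noteq> 0}"]) auto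

lemma Lap_s_ell2: "Lap s \<in> ell2 UNIV m"
  unfolding Lap_s by (rule finite_support_ell2) (rule finite_subset[of _ "{0}"], auto)

text \<open>From 1 on, \<open>s\<close> is at least \<open>s 1\<close> > 0; the comparison is only
  eventual because \<open>s 0\<close> = 0.\<close>

lemma summable_m:
  assumes "summable (\<lambda>x. (s x)\<^sup>2 * m x)"
  shows "summable m"
proof (rule summable_comparison_test_ev)
  have s1: "0 < s 1" using \<beta>_pos[of 0] by (simp add: s_def)
  show "summable (\<lambda>x. (s x)\<^sup>2 * m x / (s 1)\<^sup>2)" using assms by (rule summable_divide)
  have "norm (m x) \<le> (s x)\<^sup>2 * m x / (s 1)\<^sup>2" if "x \<ge> 1" for x
  proof -
    have "(s 1)\<^sup>2 \<le> (s x)\<^sup>2" using s1 s_mono[OF that] by (intro power_mono) auto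
    then have "(s 1)\<^sup>2 * m x \<le> (s x)\<^sup>2 * m x" using m_gt_0[of x] by (intro mult_right_mono) auto
    then show ?thesis using s1 m_gt_0[of x] by (simp add: field_simps)
  qed
  then show "eventually (\<lambda>x. norm (m x) \<le> (s x)\<^sup>2 * m x / (s 1)\<^sup>2) sequentially"
    unfolding eventually_sequentially by blast
qed

lemma inner_Lap_s: "ell2_inner UNIV m (Lap s) f = - f 0"
proof -
  have "ell2_inner UNIV m (Lap s) f = (\<Sum>\<^sub>\<infinity>x\<in>{0}. Lap s x * f x * m x)"
    unfolding ell2_inner_def by (intro infsum_cong_neutral) (auto simp: Lap_s)
  then show ?thesis using m_gt_0[of 0] by (simp add: Lap_s)
qed

lemma not_max_symmetric:
  assumes "summable (\<lambda>x. (s x)\<^sup>2 * m x)"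
  shows "\<not> max_symmetric UNIV b m"
proof
  assume sym: "max_symmetric UNIV b m"
  have "s \<in> ell2 UNIV m" "(\<lambda>x. 1) \<in> ell2 UNIV m"
    using assms summable_m[OF assms] by (simp_all add: ell2_iff)
  then have "ell2_inner UNIV m (Lap s) (\<lambda>x. 1) = ell2_inner UNIV m s (Lap (\<lambda>x. 1))"
    using sym Lap_s_ell2 unfolding max_symmetric_def by (simp add: Lap_const ell2_0)
  then show False by (simp add: inner_Lap_s Lap_const) (simp add: ell2_inner_def)
qed

text \<open>The solution of \<open>\<Delta> u = - u\<close> is increasing and grows at least as fast as \<open>s\<close>, so
  it is not square summable when \<open>s\<close> is not; \<open>pos_sol_aux\<close> carries along the sum of \<open>m u\<close>.\<close>

primrec pos_sol_aux :: "nat \<Rightarrow> real \<times> real" where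
  "pos_sol_aux 0 = (1, m 0)"
| "pos_sol_aux (Suc n) =
    (let w = fst (pos_sol_aux n) + snd (pos_sol_aux n) / \<beta> n in (w, snd (pos_sol_aux n) + m (Suc n) * w))"

definition "pos_sol n = fst (pos_sol_aux n)"

lemma pos_sol_sum: "(\<Sum>x\<le>n. m x * pos_sol x) = snd (pos_sol_aux n)"
  by (induction n) (simp_all add: pos_sol_def Let_def)

lemma pos_sol_diff: "\<beta> n * (pos_sol (Suc n) - pos_sol n) = (\<Sum>x\<le>n. m x * pos_sol x)"
  unfolding pos_sol_sum using \<beta>_pos[of n] by (simp add: pos_sol_def Let_def)

lemma Lap_pos_sol: "Lap pos_sol = (\<lambda>x. - pos_sol x)"
  by (rule Lap_eqI) (simp add: sum_negf flip: pos_sol_diff, simp add: algebra_simps)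

text \<open>The three bounds feed each other: u \<ge> 1 keeps the sum of m u above its first term
  m(0), so the increments of u are at least m(0) / \<open>\<beta> n\<close>, which keeps u above 1
  and above m(0) s.\<close>

lemma pos_sol_ge: "1 \<le> pos_sol n \<and> m 0 \<le> (\<Sum>x\<le>n. m x * pos_sol x) \<and> m 0 * s n \<le> pos_sol n"
proof (induction n)
  case 0
  then show ?case by (simp add: pos_sol_def s_0)
next
  case (Suc n)
  have eq: "pos_sol (Suc n) = pos_sol n + (\<Sum>x\<le>n. m x * pos_sol x) / \<beta> n"
    using pos_sol_diff[of n] \<beta>_pos[of n] by (simp add: field_simps)
  have "m 0 / \<beta> n \<le> (\<Sum>x\<le>n. m x * pos_sol x) / \<beta> n"
    using Suc \<beta>_pos[of n] by (intro divide_right_mono) auto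
  moreover have "0 < m 0 / \<beta> n" using \<beta>_pos[of n] m_gt_0[of 0] by simp
  ultimately have 1: "1 \<le> pos_sol (Suc n)" "m 0 * s (Suc n) \<le> pos_sol (Suc n)"
    using Suc by (simp_all add: eq s_Suc distrib_left)
  have "0 \<le> m (Suc n) * pos_sol (Suc n)" using 1 m_gt_0[of "Suc n"] by simp
  then show ?case using 1 Suc by simp
qed

section \<open>Divergent series: the Wronskian vanishes at infinity\<close>

context
  assumes not_summable: "\<not> summable (\<lambda>x. (s x)\<^sup>2 * m x)"
begin

definition "A n = (\<Sum>x\<le>n. (pos_sol x)\<^sup>2 * m x)"

lemma A_at_top: "filterlim A at_top sequentially"
  unfolding A_def[abs_def]
proof (rule nonneg_not_summable_at_top)
  show "0 \<le> (pos_sol x)\<^sup>2 * m x" for x using m_gt_0[of x] by simp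
  show "\<not> summable (\<lambda>x. (pos_sol x)\<^sup>2 * m x)"
  proof
    assume "summable (\<lambda>x. (pos_sol x)\<^sup>2 * m x)"
    then have "summable (\<lambda>x. (pos_sol x)\<^sup>2 * m x / (m 0)\<^sup>2)" by (rule summable_divide)
    then have "summable (\<lambda>x. (s x)\<^sup>2 * m x)"
    proof (rule summable_comparison_test'[where N = 0])
      fix x
      have "(m 0 * s x)\<^sup>2 \<le> (pos_sol x)\<^sup>2"
        using pos_sol_ge[of x] s_nonneg[of x] m_gt_0[of 0] by (intro power_mono) auto
      then have "(m 0 * s x)\<^sup>2 * m x \<le> (pos_sol x)\<^sup>2 * m x"
        using m_gt_0[of x] by (intro mult_right_mono) auto
      then show "norm ((s x)\<^sup>2 * m x) \<le> (pos_sol x)\<^sup>2 * m x / (m 0)\<^sup>2"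
        using m_gt_0[of 0] m_gt_0[of x] by (simp add: field_simps)
    qed
    with not_summable show False by blast
  qed
qed

lemma A_pos: "0 < A n"
  unfolding A_def using pos_sol_ge m_gt_0
  by (intro sum_pos) (auto intro!: mult_pos_pos zero_less_power simp: less_le_trans[OF zero_less_one])

text \<open>\<open>f - c u\<close> with \<open>c = f (n + 1) / u (n + 1)\<close> satisfies a Dirichlet condition at \<open>n + 1\<close>, so
  positivity of the Laplacian bounds its norm on \<open>{0..n}\<close> by that of \<open>\<Delta> f + f\<close>.\<close>

lemma ratio_bound:
  assumes f: "f \<in> ell2 UNIV m" and Lf: "Lap f \<in> ell2 UNIV m"
  shows "\<exists>K. \<forall>n. (f (Suc n) / pos_sol (Suc n))\<^sup>2 * A n \<le> K"
proof -
  define F where "F = (\<lambda>x. Lap f x + f x)"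
  have F: "F \<in> ell2 UNIV m" unfolding F_def by (rule ell2_add[OF Lf f])
  define N where "N = (\<lambda>g::nat\<Rightarrow>real. \<Sum>x. (g x)\<^sup>2 * m x)"
  have N: "(\<Sum>x\<le>n. (g x)\<^sup>2 * m x) \<le> N g" if "g \<in> ell2 UNIV m" for g n
    unfolding N_def using that m_gt_0 by (intro sum_le_suminf) (auto simp: ell2_iff less_imp_le)
  have "(f (Suc n) / pos_sol (Suc n))\<^sup>2 * A n \<le> 2 * N f + 2 * N F" for n
  proof -
    define c where "c = f (Suc n) / pos_sol (Suc n)"
    define g where "g = (\<lambda>x. f x - c * pos_sol x)"
    have "pos_sol (Suc n) > 0" using pos_sol_ge[of "Suc n"] by linarith
    then have g0: "g (Suc n) = 0" by (simp add: g_def c_def)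
    have Lg: "Lap g = (\<lambda>x. F x - g x)"
    proof (rule Lap_eqI)
      fix k
      have "(\<Sum>x\<le>k. m x * (F x - g x)) = (\<Sum>x\<le>k. m x * Lap f x) + c * (\<Sum>x\<le>k. m x * pos_sol x)"
        by (simp add: F_def g_def sum.distrib sum_distrib_left algebra_simps)
      also have "\<dots> = \<beta> k * (g k - g (Suc k))"
        by (simp add: sum_Lap g_def algebra_simps flip: pos_sol_diff)
      finally show "(\<Sum>x\<le>k. m x * (F x - g x)) = \<beta> k * (g k - g (Suc k))" .
    qed
    have "0 \<le> (\<Sum>x\<le>n. m x * Lap g x * g x)"
    proof -
      have "0 \<le> (\<Sum>k<n. \<beta> k * (g (Suc k) - g k)\<^sup>2)"
        using \<beta>_pos by (intro sum_nonneg) (auto simp: less_imp_le)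
      moreover have "0 \<le> \<beta> n * (g n - g (Suc n)) * g n" using \<beta>_pos[of n] by (simp add: g0 mult.assoc)
      ultimately show ?thesis unfolding energy_chain by simp
    qed
    then have 1: "(\<Sum>x\<le>n. (g x)\<^sup>2 * m x) \<le> (\<Sum>x\<le>n. F x * g x * m x)"
      by (simp add: Lg power2_eq_square algebra_simps sum_subtractf)
    have "(\<Sum>x\<le>n. 2 * (F x * g x * m x)) \<le> (\<Sum>x\<le>n. (F x)\<^sup>2 * m x + (g x)\<^sup>2 * m x)"
    proof (intro sum_mono)
      fix x
      show "2 * (F x * g x * m x) \<le> (F x)\<^sup>2 * m x + (g x)\<^sup>2 * m x"
        using mult_right_mono[OF sum_squares_bound[of "F x" "g x"] less_imp_le[OF m_gt_0[of x]]]
        by (simp add: algebra_simps)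
    qed
    \<comment> \<open>With \<open>1\<close> this bounds the norm of g on {0..n} by that of
      \<open>F\<close>; as c u = f - g, the constant 2 \<open>N f\<close> + 2 \<open>N F\<close>
      follows.\<close>
    then have 2: "2 * (\<Sum>x\<le>n. F x * g x * m x) \<le> (\<Sum>x\<le>n. (F x)\<^sup>2 * m x) + (\<Sum>x\<le>n. (g x)\<^sup>2 * m x)"
      by (simp add: sum.distrib sum_distrib_left)
    have "c\<^sup>2 * A n = (\<Sum>x\<le>n. (f x - g x)\<^sup>2 * m x)"
      by (simp add: A_def g_def sum_distrib_left power_mult_distrib mult.assoc)
    also have "\<dots> \<le> (\<Sum>x\<le>n. 2 * ((f x)\<^sup>2 * m x) + 2 * ((g x)\<^sup>2 * m x))"
    proof (intro sum_mono)
      fix x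
      have "(f x - g x)\<^sup>2 \<le> 2 * (f x)\<^sup>2 + 2 * (g x)\<^sup>2"
        using sum_squares_bound[of "- f x" "g x"] by (simp add: power2_diff)
      from mult_right_mono[OF this less_imp_le[OF m_gt_0[of x]]]
      show "(f x - g x)\<^sup>2 * m x \<le> 2 * ((f x)\<^sup>2 * m x) + 2 * ((g x)\<^sup>2 * m x)"
        by (simp add: algebra_simps)
    qed
    also have "\<dots> = 2 * (\<Sum>x\<le>n. (f x)\<^sup>2 * m x) + 2 * (\<Sum>x\<le>n. (g x)\<^sup>2 * m x)"
      by (simp add: sum.distrib sum_distrib_left)
    also have "\<dots> \<le> 2 * N f + 2 * N F"
      using 1 2 N[OF f, of n] N[OF F, of n] by linarith
    finally show ?thesis by (simp add: c_def)
  qed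
  then show ?thesis by blast
qed

text \<open>Cauchy-Schwarz on {0..n} would only give boundedness. A fixed initial segment is
  negligible because \<open>A\<close> diverges, and beyond it the norm of \<open>F\<close> is
  small.\<close>

lemma weighted_sum_div_sqrt_A_tendsto_0:
  assumes F: "F \<in> ell2 UNIV m"
  shows "(\<lambda>n. (\<Sum>x\<le>n. F x * pos_sol x * m x) / sqrt (A n)) \<longlonglongrightarrow> 0"
proof (rule LIMSEQ_I)
  fix e :: real assume e: "0 < e"
  have sF: "summable (\<lambda>x. (F x)\<^sup>2 * m x)" using F by (simp add: ell2_iff)
  have "0 < (e / 2)\<^sup>2" using e by simp
  from suminf_exist_split[OF this sF] obtain N
    where N: "\<And>k. k \<ge> N \<Longrightarrow> norm (\<Sum>i. (F (i + k))\<^sup>2 * m (i + k)) < (e / 2)\<^sup>2" by blast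
  define H where "H = \<bar>\<Sum>x<N. F x * pos_sol x * m x\<bar>"
  have sq: "filterlim (\<lambda>n. sqrt (A n)) at_top sequentially"
    by (rule filterlim_compose[OF sqrt_at_top A_at_top])
  have "(\<lambda>n. H / sqrt (A n)) \<longlonglongrightarrow> 0"
    by (rule tendsto_divide_0[OF tendsto_const filterlim_at_top_imp_at_infinity[OF sq]])
  then obtain M where M: "\<And>n. n \<ge> M \<Longrightarrow> norm (H / sqrt (A n) - 0) < e / 2"
    using e LIMSEQ_D[of _ 0 "e / 2"] by (metis half_gt_zero)
  have "norm ((\<Sum>x\<le>n. F x * pos_sol x * m x) / sqrt (A n) - 0) < e" if n: "n \<ge> max M N" for n
  proof -
    have An: "0 < sqrt (A n)" using A_pos by simp
    have split: "(\<Sum>x\<le>n. F x * pos_sol x * m x) =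
        (\<Sum>x<N. F x * pos_sol x * m x) + (\<Sum>x\<in>{N..n}. F x * pos_sol x * m x)"
    proof -
      have "{..n} = {..<N} \<union> {N..n}" using n by auto
      then show ?thesis by (simp add: sum.union_disjoint ivl_disj_int)
    qed
    have tail: "\<bar>\<Sum>x\<in>{N..n}. F x * pos_sol x * m x\<bar> \<le> (e / 2) * sqrt (A n)"
    proof -
      have "(\<Sum>x\<in>{N..n}. (F x * sqrt (m x)) * (pos_sol x * sqrt (m x)))\<^sup>2 \<le>
          (\<Sum>x\<in>{N..n}. (F x * sqrt (m x))\<^sup>2) * (\<Sum>x\<in>{N..n}. (pos_sol x * sqrt (m x))\<^sup>2)"
        by (rule Cauchy_Schwarz_ineq_sum)
      also have "(\<Sum>x\<in>{N..n}. (F x * sqrt (m x)) * (pos_sol x * sqrt (m x))) =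
          (\<Sum>x\<in>{N..n}. F x * pos_sol x * m x)"
        using m_gt_0 by (intro sum.cong) (auto simp: less_imp_le)
      also have "(\<Sum>x\<in>{N..n}. (F x * sqrt (m x))\<^sup>2) = (\<Sum>x\<in>{N..n}. (F x)\<^sup>2 * m x)"
        using m_gt_0 by (intro sum.cong) (auto simp: less_imp_le power_mult_distrib)
      also have "(\<Sum>x\<in>{N..n}. (pos_sol x * sqrt (m x))\<^sup>2) = (\<Sum>x\<in>{N..n}. (pos_sol x)\<^sup>2 * m x)"
        using m_gt_0 by (intro sum.cong) (auto simp: less_imp_le power_mult_distrib)
      also have "(\<Sum>x\<in>{N..n}. (F x)\<^sup>2 * m x) * (\<Sum>x\<in>{N..n}. (pos_sol x)\<^sup>2 * m x) \<le> (e / 2)\<^sup>2 * A n"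
      proof (intro mult_mono)
        have "(\<Sum>x\<in>{N..n}. (F x)\<^sup>2 * m x) = (\<Sum>i<Suc n - N. (F (i + N))\<^sup>2 * m (i + N))"
          by (rule sum.reindex_bij_witness[of _ "\<lambda>i. i + N" "\<lambda>x. x - N"]) auto
        also have "\<dots> \<le> (\<Sum>i. (F (i + N))\<^sup>2 * m (i + N))"
          using sF m_gt_0 by (intro sum_le_suminf) (auto simp: less_imp_le summable_iff_shift[of "\<lambda>x. (F x)\<^sup>2 * m x"])
        also have "\<dots> \<le> (e / 2)\<^sup>2" using N[of N] by simp
        finally show "(\<Sum>x\<in>{N..n}. (F x)\<^sup>2 * m x) \<le> (e / 2)\<^sup>2" .
        show "(\<Sum>x\<in>{N..n}. (pos_sol x)\<^sup>2 * m x) \<le> A n"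
          unfolding A_def using m_gt_0 by (intro sum_mono2) (auto simp: less_imp_le)
        show "0 \<le> (\<Sum>x\<in>{N..n}. (pos_sol x)\<^sup>2 * m x)"
          using m_gt_0 by (intro sum_nonneg) (auto simp: less_imp_le)
      qed simp
      finally have "sqrt ((\<Sum>x\<in>{N..n}. F x * pos_sol x * m x)\<^sup>2) \<le> sqrt ((e / 2)\<^sup>2 * A n)"
        by (rule real_sqrt_le_mono)
      then show ?thesis using e by (simp add: real_sqrt_mult)
    qed
    have "\<bar>\<Sum>x\<le>n. F x * pos_sol x * m x\<bar> \<le> H + (e / 2) * sqrt (A n)"
      unfolding split H_def using tail by linarith
    moreover have "H < (e / 2) * sqrt (A n)"
      using M[of n] n An by (simp add: H_def field_simps)
    ultimately have "\<bar>\<Sum>x\<le>n. F x * pos_sol x * m x\<bar> < e * sqrt (A n)" by simp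
    then show ?thesis using An by (simp add: field_simps)
  qed
  then show "\<exists>no. \<forall>n\<ge>no. norm ((\<Sum>x\<le>n. F x * pos_sol x * m x) / sqrt (A n) - 0) < e" by blast
qed

text \<open>The ratio times sqrt (\<open>A n\<close>) is bounded, and the sum divided by sqrt
  (\<open>A n\<close>) tends to 0.\<close>

lemma ratio_times_sum_tendsto_0:
  assumes f: "f \<in> ell2 UNIV m" and Lf: "Lap f \<in> ell2 UNIV m" and F: "F \<in> ell2 UNIV m"
  shows "(\<lambda>n. f (Suc n) / pos_sol (Suc n) * (\<Sum>x\<le>n. F x * pos_sol x * m x)) \<longlonglongrightarrow> 0"
proof -
  obtain K where K: "\<And>n. (f (Suc n) / pos_sol (Suc n))\<^sup>2 * A n \<le> K"
    using ratio_bound[OF f Lf] by blast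
  have "\<bar>f (Suc n) / pos_sol (Suc n) * sqrt (A n)\<bar> \<le> sqrt K" for n
  proof -
    have "(f (Suc n) / pos_sol (Suc n) * sqrt (A n))\<^sup>2 \<le> K"
      using K[of n] A_pos[of n] by (simp add: power_mult_distrib del: times_divide_eq_left)
    from real_sqrt_le_mono[OF this] show ?thesis by simp
  qed
  then have "Bfun (\<lambda>n. f (Suc n) / pos_sol (Suc n) * sqrt (A n)) sequentially"
    by (intro BfunI[of _ "sqrt K"]) simp
  from bounded_bilinear.Bfun_prod_Zfun[OF bounded_bilinear_mult this
      tendsto_Zfun_iff[THEN iffD1, OF weighted_sum_div_sqrt_A_tendsto_0[OF F], unfolded diff_zero]]
  have "Zfun (\<lambda>n. f (Suc n) / pos_sol (Suc n) * sqrt (A n) *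
      ((\<Sum>x\<le>n. F x * pos_sol x * m x) / sqrt (A n))) sequentially" .
  moreover have "f (Suc n) / pos_sol (Suc n) * sqrt (A n) * ((\<Sum>x\<le>n. F x * pos_sol x * m x) / sqrt (A n))
      = f (Suc n) / pos_sol (Suc n) * (\<Sum>x\<le>n. F x * pos_sol x * m x)" for n
    using A_pos[of n] by simp
  ultimately show ?thesis by (simp add: tendsto_Zfun_iff)
qed

lemma max_symmetric_chain: "max_symmetric UNIV b m"
  unfolding max_symmetric_def
proof (intro ballI impI)
  fix f g assume f: "f \<in> ell2 UNIV m" and g: "g \<in> ell2 UNIV m"
    and Lf: "Lap f \<in> ell2 UNIV m" and Lg: "Lap g \<in> ell2 UNIV m"
  let ?u = pos_sol
  define W where "W f g n = \<beta> n * (f n * g (Suc n) - f (Suc n) * g n)" for f g :: "nat \<Rightarrow> real" and n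
  \<comment> \<open>Because the Laplacian of u is -u, Green's formula makes the Wronskian with u a
    pairing of u with Lap f + f, which lies in \<open>ell2\<close>.\<close>
  have Wu: "W f ?u n = (\<Sum>x\<le>n. (Lap f x + f x) * ?u x * m x)" for f n
  proof -
    have "W f ?u n = (\<Sum>x\<le>n. m x * Lap f x * ?u x) - (\<Sum>x\<le>n. m x * Lap ?u x * f x)"
      unfolding W_def Green_chain ..
    also have "\<dots> = (\<Sum>x\<le>n. (Lap f x + f x) * ?u x * m x)"
      by (simp add: Lap_pos_sol algebra_simps flip: sum_subtractf)
    finally show ?thesis .
  qed
  have Wfg: "W f g n = g (Suc n) / ?u (Suc n) * W f ?u n - f (Suc n) / ?u (Suc n) * W g ?u n" for n
  proof -
    have "?u (Suc n) > 0" using pos_sol_ge[of "Suc n"] by linarith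
    then show ?thesis unfolding W_def by (intro Wronskian_identity) simp
  qed
  \<comment> \<open>The same sequence converges to the defect of symmetry, which therefore
    vanishes.\<close>
  have "W f g \<longlonglongrightarrow> 0 - 0"
    unfolding Wfg[abs_def] Wu
    by (intro tendsto_diff ratio_times_sum_tendsto_0 ell2_add f g Lf Lg)
  moreover have "W f g \<longlonglongrightarrow> ell2_inner UNIV m (Lap f) g - ell2_inner UNIV m (Lap g) f"
  proof -
    have "W f g = (\<lambda>n. (\<Sum>x\<le>n. Lap f x * g x * m x) - (\<Sum>x\<le>n. Lap g x * f x * m x))"
      unfolding W_def[abs_def] Green_chain[symmetric] by (simp add: mult_ac)
    then show ?thesis using tendsto_diff[OF inner_partial_sums[OF Lf g] inner_partial_sums[OF Lg f]] by simp
  qed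
  ultimately have "ell2_inner UNIV m (Lap f) g - ell2_inner UNIV m (Lap g) f = 0 - 0"
    by (rule LIMSEQ_unique[rotated])
  then show "ell2_inner UNIV m (Lap f) g = ell2_inner UNIV m f (Lap g)"
    by (simp add: inner_commute)
qed

end

theorem max_symmetric_iff_not_summable:
  "max_symmetric UNIV b m \<longleftrightarrow> \<not> summable (\<lambda>x. (s x)\<^sup>2 * m x)"
  using max_symmetric_chain not_max_symmetric by blast

end

section \<open>Capacity at infinity\<close>

context birth_death
begin

lemma energy_eventually_const:
  assumes f: "\<And>r. r \<ge> n \<Longrightarrow> f r = f n"
  shows "finite_energy b f" "energy b f = (\<Sum>k<n. \<beta> k * (f (Suc k) - f k)\<^sup>2)"
proof -
  let ?h = "\<lambda>(x, y). b x y * (f x - f y)\<^sup>2"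
  \<comment> \<open>Every edge is listed in both orientations, which absorbs the factor 1/2 of
    \<open>energy\<close>.\<close>
  define E1 where "E1 = (\<lambda>k. (k, Suc k)) ` {..<n}"
  define E2 where "E2 = (\<lambda>k. (Suc k, k)) ` {..<n}"
  have zero: "?h z = 0" if z: "z \<notin> E1 \<union> E2" for z
  proof -
    obtain x y where [simp]: "z = (x, y)" by fastforce
    show ?thesis
    proof (cases "\<bar>int x - int y\<bar> = 1")
      case True
      then have "y = Suc x \<or> x = Suc y" by linarith
      moreover have "n \<le> x" if "y = Suc x" using z that unfolding E1_def by fastforce
      moreover have "n \<le> y" if "x = Suc y" using z that unfolding E2_def by fastforce
      ultimately have "f x = f y" using f[of x] f[of y] by auto
      then show ?thesis by simp
    qed (simp add: b_zero)
  qed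
  have fin: "finite (E1 \<union> E2)" by (simp add: E1_def E2_def)
  show "finite_energy b f"
    unfolding finite_energy_def
    using zero by (intro finite_nonzero_values_imp_summable_on finite_subset[OF _ fin]) blast
  have "(\<Sum>\<^sub>\<infinity>z. ?h z) = (\<Sum>\<^sub>\<infinity>z\<in>E1 \<union> E2. ?h z)"
    using zero by (intro infsum_cong_neutral) blast+
  also have "\<dots> = (\<Sum>z\<in>E1 \<union> E2. ?h z)" using fin by (rule infsum_finite)
  also have "\<dots> = (\<Sum>z\<in>E1. ?h z) + (\<Sum>z\<in>E2. ?h z)"
    by (intro sum.union_disjoint) (auto simp: E1_def E2_def)
  also have "(\<Sum>z\<in>E1. ?h z) = (\<Sum>k<n. \<beta> k * (f (Suc k) - f k)\<^sup>2)"
    unfolding E1_def by (subst sum.reindex) (auto simp: inj_on_def b_Suc power2_commute)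
  also have "(\<Sum>z\<in>E2. ?h z) = (\<Sum>k<n. \<beta> k * (f (Suc k) - f k)\<^sup>2)"
    unfolding E2_def by (subst sum.reindex) (auto simp: inj_on_def b_Suc)
  finally show "energy b f = (\<Sum>k<n. \<beta> k * (f (Suc k) - f k)\<^sup>2)" by (simp add: energy_def)
qed

text \<open>A function that is finally 1 has a finitely supported Laplacian and finite energy, so
  only its own square summability is at stake. Hence the class is empty for all n or for
  none.\<close>

lemma cap_class_eq:
  "cap_class b m n = (if summable m then {f. \<forall>r\<ge>n. f r = 1} else {})"
proof -
  have "f \<in> H2 b m \<longleftrightarrow> summable m" if f: "\<forall>r\<ge>n. f r = 1" for f
  proof -
    have "eventually (\<lambda>x. (f x)\<^sup>2 * m x = m x) sequentially"
      unfolding eventually_sequentially using f by (intro exI[of _ n]) simp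
    then have 1: "f \<in> ell2 UNIV m \<longleftrightarrow> summable m" unfolding ell2_iff by (rule summable_cong)
    \<comment> \<open>Not claimed at x = n, whose left neighbour may carry another value.\<close>
    have "Lap f x = 0" if x: "x > n" for x
    proof -
      obtain k where k: "x = Suc k" "k \<ge> n" using x by (cases x) auto
      then show ?thesis using Lap_Suc[of k f] f m_gt_0[of x] by simp
    qed
    then have "{x. Lap f x \<noteq> 0} \<subseteq> {..n}" by (auto simp: not_less[symmetric])
    then have 2: "Lap f \<in> ell2 UNIV m" by (intro finite_support_ell2) (rule finite_subset, auto)
    have "finite_energy b f" by (rule energy_eventually_const(1)[of n]) (simp add: f)
    then show ?thesis using 1 2 by (simp add: H2_def)
  qed
  then show ?thesis by (auto simp: cap_class_def)
qed

lemma energy_nonneg: "0 \<le> energy b f"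
proof -
  have "0 \<le> b x y" for x y
    using chain by (simp add: birth_death_chain_def weighted_graph_def)
  then show ?thesis unfolding energy_def by (intro mult_nonneg_nonneg infsum_nonneg) auto
qed

text \<open>The classes grow with n, so the infima decrease and their limit is their
  infimum.\<close>

lemma Cap22_eq_INF:
  assumes "summable m"
  shows "Cap22 b m = (INF n. INF f\<in>cap_class b m n. ereal (H2_norm_sq b m f))"
proof -
  have "(\<lambda>x. 1) \<in> cap_class b m n" for n using assms by (simp add: cap_class_eq)
  then have ne: "\<not> (\<exists>n. cap_class b m n = {})" by blast
  have "decseq (\<lambda>n. INF f\<in>cap_class b m n. ereal (H2_norm_sq b m f))"
    unfolding decseq_def using assms by (intro allI impI INF_superset_mono) (auto simp: cap_class_eq)
  from limI[OF LIMSEQ_INF[OF this]] show ?thesis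
    using ne by (simp add: Cap22_def)
qed

text \<open>Where f is constantly 1, its Wronskian with \<open>s\<close> is the unit flux of
  \<open>s\<close>. This normalisation survives for every n and is what keeps the capacity away from
  0.\<close>

lemma inner_s_Lap:
  assumes "s \<in> ell2 UNIV m" "f \<in> ell2 UNIV m" "Lap f \<in> ell2 UNIV m" "\<And>r. r \<ge> n \<Longrightarrow> f r = 1"
  shows "ell2_inner UNIV m (Lap f) s - ell2_inner UNIV m (Lap s) f = 1"
proof (rule LIMSEQ_unique)
  let ?W = "\<lambda>n. (\<Sum>x\<le>n. Lap f x * s x * m x) - (\<Sum>x\<le>n. Lap s x * f x * m x)"
  show "?W \<longlonglongrightarrow> ell2_inner UNIV m (Lap f) s - ell2_inner UNIV m (Lap s) f"
    by (intro tendsto_diff inner_partial_sums assms Lap_s_ell2)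
  have "?W k = 1" if "k \<ge> n" for k
  proof -
    have "?W k = (\<Sum>x\<le>k. m x * Lap f x * s x) - (\<Sum>x\<le>k. m x * Lap s x * f x)"
      by (simp add: mult_ac)
    also have "\<dots> = \<beta> k * (f k * s (Suc k) - f (Suc k) * s k)" by (rule Green_chain)
    also have "\<dots> = 1" using assms(4) that \<beta>_pos[of k] by (simp add: s_Suc)
    finally show ?thesis .
  qed
  then have "eventually (\<lambda>k. ?W k = 1) sequentially"
    unfolding eventually_sequentially by blast
  then show "?W \<longlonglongrightarrow> 1" by (rule tendsto_eventually)
qed

lemma norm_le_H2:
  shows "ell2_norm UNIV m f \<le> sqrt (H2_norm_sq b m f)"
    and "ell2_norm UNIV m (Lap f) \<le> sqrt (H2_norm_sq b m f)"
  using energy_nonneg[of f] by (auto intro!: real_le_rsqrt simp: H2_norm_sq_def)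

lemma Cap22_pos_finite:
  assumes sm: "summable (\<lambda>x. (s x)\<^sup>2 * m x)"
  shows "0 < Cap22 b m" "Cap22 b m < \<infinity>"
proof -
  have m: "summable m" by (rule summable_m[OF sm])
  have s: "s \<in> ell2 UNIV m" using sm by (simp add: ell2_iff)
  define P where "P = ell2_norm UNIV m s + ell2_norm UNIV m (Lap s)"
  have bound: "1 \<le> P\<^sup>2 * H2_norm_sq b m f" if "f \<in> cap_class b m n" for f n
  proof -
    have f: "f \<in> ell2 UNIV m" "Lap f \<in> ell2 UNIV m" "\<And>r. r \<ge> n \<Longrightarrow> f r = 1"
      using that by (auto simp: cap_class_def H2_def)
    let ?h = "sqrt (H2_norm_sq b m f)"
    have "1 = ell2_inner UNIV m (Lap f) s - ell2_inner UNIV m (Lap s) f"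
      using inner_s_Lap[OF s f] by simp
    also have "\<dots> \<le> ell2_norm UNIV m (Lap f) * ell2_norm UNIV m s +
        ell2_norm UNIV m (Lap s) * ell2_norm UNIV m f"
      using Cauchy_Schwarz_ell2[OF f(2) s] Cauchy_Schwarz_ell2[OF Lap_s_ell2 f(1)] by linarith
    also have "\<dots> \<le> ?h * ell2_norm UNIV m s + ell2_norm UNIV m (Lap s) * ?h"
      by (intro add_mono mult_right_mono mult_left_mono norm_le_H2)
        (simp_all add: ell2_norm_def inner_self_nonneg)
    also have "\<dots> = P * ?h" by (simp add: P_def algebra_simps)
    finally have "1 \<le> (P * ?h)\<^sup>2" by (simp add: one_le_power)
    moreover have "0 \<le> H2_norm_sq b m f"
      using energy_nonneg[of f] by (simp add: H2_norm_sq_def)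
    ultimately show ?thesis by (simp add: power_mult_distrib)
  qed
  have one: "(\<lambda>x. 1) \<in> cap_class b m 0" using m by (simp add: cap_class_eq)
  \<comment> \<open>The lower bound itself, applied to the constant 1, excludes \<open>P\<close> =
    0.\<close>
  have "P \<noteq> 0" using bound[OF one] by auto
  then have P: "0 < P\<^sup>2" by simp
  have "ereal (1 / P\<^sup>2) \<le> Cap22 b m"
    unfolding Cap22_eq_INF[OF m]
  proof (intro INF_greatest)
    fix n f assume "f \<in> cap_class b m n"
    from bound[OF this] show "ereal (1 / P\<^sup>2) \<le> ereal (H2_norm_sq b m f)"
      using P by (simp add: field_simps)
  qed
  then show "0 < Cap22 b m" using P by (metis ereal_less(2) order_less_le_trans zero_less_divide_1_iff)
  have "Cap22 b m \<le> ereal (H2_norm_sq b m (\<lambda>x. 1))"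
    unfolding Cap22_eq_INF[OF m]
    by (intro INF_lower2[of 0] INF_lower2[of "\<lambda>x. 1"]) (simp_all add: one)
  then show "Cap22 b m < \<infinity>" by (rule order_le_less_trans) simp
qed

text \<open>Cutting the sum of \<open>s\<^sup>2 m\<close> at \<open>M\<close>, these are the functions equal to \<open>1\<close> from \<open>M\<close> on whose
  Laplacian is a multiple of \<open>s\<close> on \<open>{1..M}\<close>; \<open>flux M k\<close> is \<open>\<beta> k\<close> times the increment.\<close>

definition "T M = (\<Sum>x\<le>M. (s x)\<^sup>2 * m x)"
definition "flux M k = (\<Sum>x\<in>{k<..M}. m x * s x) / T M"
definition "equi M x = (\<Sum>k<x. flux M k / \<beta> k)"

section \<open>Estimates for the test functions\<close>

lemma T_nonneg: "0 \<le> T M"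
  unfolding T_def using m_gt_0 by (intro sum_nonneg) (simp add: less_imp_le)

lemma flux_nonneg: "0 \<le> flux M k"
  unfolding flux_def using m_gt_0 s_nonneg T_nonneg
  by (intro divide_nonneg_nonneg sum_nonneg mult_nonneg_nonneg) (auto simp: less_imp_le)

lemma flux_le: "flux M k \<le> flux M 0"
  unfolding flux_def using m_gt_0 s_nonneg T_nonneg
  by (intro divide_right_mono sum_mono2 mult_nonneg_nonneg) (auto simp: less_imp_le)

lemma equi_Suc: "equi M (Suc x) - equi M x = flux M x / \<beta> x"
  by (simp add: equi_def)

text \<open>After interchanging the sums, m(x) s(x) is multiplied by the sum of 1 /
  \<open>\<beta> k\<close> over k < x, that is by s(x). The total is \<open>T M\<close>, which
  explains the denominator of \<open>flux\<close>.\<close>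

lemma equi_eq_1:
  assumes r: "M \<le> r" and T: "0 < T M"
  shows "equi M r = 1"
proof -
  have "T M * equi M r = (\<Sum>k<r. \<Sum>x\<in>{x\<in>{..M}. k < x}. m x * s x * (1 / \<beta> k))"
  proof -
    have "{k<..M} = {x\<in>{..M}. k < x}" for k by auto
    then show ?thesis
      using T by (simp add: equi_def flux_def sum_distrib_left sum_divide_distrib)
  qed
  also have "\<dots> = (\<Sum>x\<le>M. \<Sum>k\<in>{k\<in>{..<r}. k < x}. m x * s x * (1 / \<beta> k))"
    by (rule sum.swap_restrict) auto
  also have "\<dots> = (\<Sum>x\<le>M. (s x)\<^sup>2 * m x)"
  proof (intro sum.cong refl)
    fix x assume "x \<in> {..M}"
    then have "{k\<in>{..<r}. k < x} = {..<x}" using r by auto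
    then show "(\<Sum>k\<in>{k\<in>{..<r}. k < x}. m x * s x * (1 / \<beta> k)) = (s x)\<^sup>2 * m x"
      by (simp only: sum_distrib_left[symmetric] s_def[symmetric]) (simp add: power2_eq_square)
  qed
  finally show ?thesis using T by (simp add: T_def)
qed

lemma equi_mono: "x \<le> y \<Longrightarrow> equi M x \<le> equi M y"
  unfolding equi_def using flux_nonneg \<beta>_pos by (intro sum_mono2) (auto simp: less_imp_le)

text \<open>Both upper bounds serve the norm estimate: the multiple of \<open>s\<close> is small on
  a fixed initial segment, while the bound 1 suffices on a tail of small measure.\<close>

lemma equi_bounds:
  assumes "0 < T M"
  shows "0 \<le> equi M x" "equi M x \<le> 1" "equi M x \<le> flux M 0 * s x"
proof -
  show "0 \<le> equi M x" using equi_mono[of 0 x M] by (simp add: equi_def)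
  show "equi M x \<le> 1"
    using equi_mono[of x "max x M" M] equi_eq_1[of M "max x M"] assms by simp
  have "equi M x \<le> (\<Sum>k<x. flux M 0 * (1 / \<beta> k))"
    unfolding equi_def using flux_le \<beta>_pos
    by (intro sum_mono) (simp add: divide_right_mono less_imp_le)
  then show "equi M x \<le> flux M 0 * s x" by (simp only: s_def sum_distrib_left)
qed

text \<open>The flux drops by m(x) s(x) / \<open>T M\<close> at each x in {1..M}. The origin is
  exceptional: the whole flux starts there, although \<open>s 0\<close> = 0.\<close>

lemma Lap_equi:
  "Lap (equi M) = (\<lambda>x. if x = 0 then - flux M 0 / m 0 else if x \<le> M then s x / T M else 0)"
    (is "_ = ?h")
proof (rule Lap_eqI)
  fix n
  have "(\<Sum>x\<le>n. m x * ?h x) = - flux M n"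
  proof (induction n)
    case 0
    then show ?case using m_gt_0[of 0] by simp
  next
    case (Suc n)
    have "flux M n = flux M (Suc n) + (if Suc n \<le> M then m (Suc n) * s (Suc n) / T M else 0)"
    proof (cases "Suc n \<le> M")
      case True
      then have "{n<..M} = insert (Suc n) {Suc n<..M}" by auto
      then show ?thesis using True by (simp add: flux_def add_divide_distrib)
    qed (simp add: flux_def)
    then show ?case using Suc by simp
  qed
  also have "\<dots> = \<beta> n * (equi M n - equi M (Suc n))"
    using equi_Suc[of M n] \<beta>_pos[of n] by (simp add: field_simps)
  finally show "(\<Sum>x\<le>n. m x * ?h x) = \<beta> n * (equi M n - equi M (Suc n))" .
qed

lemma norm_sq_le:
  assumes f: "f \<in> ell2 UNIV m" and K: "\<And>n. (\<Sum>x\<le>n. (f x)\<^sup>2 * m x) \<le> K"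
  shows "(ell2_norm UNIV m f)\<^sup>2 \<le> K"
  unfolding norm_sq using inner_partial_sums[OF f f] K
  by (intro LIMSEQ_le_const2) (auto simp: power2_eq_square)

text \<open>The three groups bound the squared norm, the squared norm of the Laplacian and the
  energy; the last holds since the flux is at most \<open>flux M 0\<close> and the increments up to
  M add to 1. The cutoff \<open>N\<close> is independent of \<open>M\<close>, because it will be
  fixed before \<open>M\<close> grows.\<close>

lemma equi_H2_bound:
  assumes m: "summable m" and T: "0 < T M"
  shows "H2_norm_sq b m (equi M) \<le>
    ((flux M 0)\<^sup>2 * T N + (\<Sum>i. m (i + N))) + ((flux M 0)\<^sup>2 / m 0 + 1 / T M) + flux M 0"
proof -
  let ?J = "flux M 0"
  have "equi M \<in> cap_class b m M" using m T by (simp add: cap_class_eq equi_eq_1)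
  then have mem: "equi M \<in> ell2 UNIV m" "Lap (equi M) \<in> ell2 UNIV m"
    by (simp_all add: cap_class_def H2_def)
  have "(ell2_norm UNIV m (equi M))\<^sup>2 \<le> ?J\<^sup>2 * T N + (\<Sum>i. m (i + N))"
  proof (rule norm_sq_le[OF mem(1)])
    fix n
    \<comment> \<open>The two majorants overlap at x = N, harmlessly for an upper bound.\<close>
    let ?a = "\<lambda>x. if x \<le> N then (s x)\<^sup>2 * m x else 0"
    let ?d = "\<lambda>x. if x < N then 0 else m x"
    have "(\<Sum>x\<le>n. (equi M x)\<^sup>2 * m x) \<le> (\<Sum>x\<le>n. ?J\<^sup>2 * ?a x + ?d x)"
    proof (intro sum_mono)
      fix x
      have "(equi M x)\<^sup>2 \<le> (?J * s x)\<^sup>2" "(equi M x)\<^sup>2 \<le> 1\<^sup>2"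
        using equi_bounds[OF T, of x] by (intro power_mono; simp)+
      then have "(equi M x)\<^sup>2 * m x \<le> ?J\<^sup>2 * ((s x)\<^sup>2 * m x)" "(equi M x)\<^sup>2 * m x \<le> m x"
        using mult_right_mono[of _ _ "m x"] m_gt_0[of x] by (fastforce simp: power_mult_distrib)+
      moreover have "0 \<le> ?J\<^sup>2 * ?a x" "0 \<le> m x" using m_gt_0[of x] by auto
      ultimately show "(equi M x)\<^sup>2 * m x \<le> ?J\<^sup>2 * ?a x + ?d x" by auto
    qed
    also have "\<dots> = ?J\<^sup>2 * (\<Sum>x\<le>n. ?a x) + (\<Sum>x\<le>n. ?d x)"
      by (simp add: sum.distrib sum_distrib_left)
    also have "\<dots> \<le> ?J\<^sup>2 * T N + (\<Sum>i. m (i + N))"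
    proof (intro add_mono mult_left_mono)
      have "(\<Sum>x\<le>n. ?a x) \<le> (\<Sum>x\<le>max n N. ?a x)"
        using m_gt_0 by (intro sum_mono2) (auto simp: less_imp_le)
      also have "\<dots> = T N"
        unfolding T_def by (rule sum.mono_neutral_cong_right) auto
      finally show "(\<Sum>x\<le>n. ?a x) \<le> T N" .
      have sd: "summable ?d"
        using m_gt_0 by (intro summable_comparison_test'[OF m, of 0]) (auto simp: less_imp_le)
      then have "(\<Sum>x\<le>n. ?d x) \<le> (\<Sum>x. ?d x)"
        using m_gt_0 by (intro sum_le_suminf) (auto simp: less_imp_le)
      also have "\<dots> = (\<Sum>i. m (i + N))"
        by (subst suminf_split_initial_segment[OF sd, of N]) simp
      finally show "(\<Sum>x\<le>n. ?d x) \<le> (\<Sum>i. m (i + N))" .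
    qed simp
    finally show "(\<Sum>x\<le>n. (equi M x)\<^sup>2 * m x) \<le> ?J\<^sup>2 * T N + (\<Sum>i. m (i + N))" .
  qed
  moreover have "(ell2_norm UNIV m (Lap (equi M)))\<^sup>2 \<le> ?J\<^sup>2 / m 0 + 1 / T M"
  proof (rule norm_sq_le[OF mem(2)])
    fix n
    let ?e = "\<lambda>x. if x = 0 then ?J\<^sup>2 / m 0 else 0"
    let ?a = "\<lambda>x. if x \<le> M then (s x)\<^sup>2 * m x / (T M)\<^sup>2 else 0"
    have "(\<Sum>x\<le>n. (Lap (equi M) x)\<^sup>2 * m x) \<le> (\<Sum>x\<le>max n M. (Lap (equi M) x)\<^sup>2 * m x)"
      using m_gt_0 by (intro sum_mono2) (auto simp: less_imp_le)
    also have "\<dots> = (\<Sum>x\<le>max n M. ?e x + ?a x)"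
      using m_gt_0[of 0] by (intro sum.cong) (auto simp: Lap_equi s_0 power_divide power2_eq_square[of "m 0"])
    also have "\<dots> = (\<Sum>x\<le>max n M. ?e x) + (\<Sum>x\<le>max n M. ?a x)" by (rule sum.distrib)
    also have "(\<Sum>x\<le>max n M. ?e x) = (\<Sum>x\<in>{0::nat}. ?J\<^sup>2 / m 0)"
      by (rule sum.mono_neutral_cong_right) auto
    also have "(\<Sum>x\<le>max n M. ?a x) = (\<Sum>x\<le>M. (s x)\<^sup>2 * m x / (T M)\<^sup>2)"
      by (rule sum.mono_neutral_cong_right) auto
    also have "\<dots> = T M / (T M)\<^sup>2" by (simp add: T_def sum_divide_distrib)
    also have "\<dots> = 1 / T M" using T by (simp add: power2_eq_square)
    finally show "(\<Sum>x\<le>n. (Lap (equi M) x)\<^sup>2 * m x) \<le> ?J\<^sup>2 / m 0 + 1 / T M" by simp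
  qed
  moreover have "energy b (equi M) \<le> ?J"
  proof -
    have "energy b (equi M) = (\<Sum>k<M. \<beta> k * (equi M (Suc k) - equi M k)\<^sup>2)"
      using T by (intro energy_eventually_const(2)) (simp add: equi_eq_1)
    also have "\<dots> = (\<Sum>k<M. flux M k * (flux M k / \<beta> k))"
      unfolding equi_Suc using \<beta>_pos by (intro sum.cong) (auto simp: power2_eq_square less_le)
    also have "\<dots> \<le> (\<Sum>k<M. ?J * (flux M k / \<beta> k))"
      using flux_le flux_nonneg \<beta>_pos
      by (intro sum_mono mult_right_mono divide_nonneg_nonneg) (auto simp: less_imp_le)
    also have "\<dots> = ?J * equi M M" by (simp add: equi_def sum_distrib_left)
    also have "\<dots> = ?J" using equi_eq_1[OF order_refl T] by simp
    finally show ?thesis .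
  qed
  ultimately show ?thesis unfolding H2_norm_sq_def by linarith
qed

text \<open>Cauchy-Schwarz for sqrt m and s sqrt m: the sum of m s grows at most like the square
  root of \<open>T M\<close>, so dividing it by \<open>T M\<close> gives a flux that tends to
  0.\<close>

lemma flux_sq_le:
  assumes m: "summable m" and T: "0 < T M"
  shows "(flux M 0)\<^sup>2 \<le> suminf m / T M"
proof -
  have "(\<Sum>x\<in>{0<..M}. (sqrt (m x)) * (s x * sqrt (m x)))\<^sup>2 \<le>
      (\<Sum>x\<in>{0<..M}. (sqrt (m x))\<^sup>2) * (\<Sum>x\<in>{0<..M}. (s x * sqrt (m x))\<^sup>2)"
    by (rule Cauchy_Schwarz_ineq_sum)
  also have "(\<Sum>x\<in>{0<..M}. (sqrt (m x)) * (s x * sqrt (m x))) = (\<Sum>x\<in>{0<..M}. m x * s x)"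
    using m_gt_0 by (intro sum.cong) (auto simp: less_imp_le)
  also have "(\<Sum>x\<in>{0<..M}. (sqrt (m x))\<^sup>2) = (\<Sum>x\<in>{0<..M}. m x)"
    using m_gt_0 by (intro sum.cong) (auto simp: less_imp_le)
  also have "(\<Sum>x\<in>{0<..M}. (s x * sqrt (m x))\<^sup>2) = (\<Sum>x\<in>{0<..M}. (s x)\<^sup>2 * m x)"
    using m_gt_0 by (intro sum.cong) (auto simp: less_imp_le power_mult_distrib)
  also have "(\<Sum>x\<in>{0<..M}. m x) * (\<Sum>x\<in>{0<..M}. (s x)\<^sup>2 * m x) \<le> suminf m * T M"
  proof (intro mult_mono)
    show "sum m {0<..M} \<le> suminf m"
      using m m_gt_0 by (intro sum_le_suminf) (auto simp: less_imp_le)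
    show "(\<Sum>x\<in>{0<..M}. (s x)\<^sup>2 * m x) \<le> T M"
      unfolding T_def using m_gt_0 by (intro sum_mono2) (auto simp: less_imp_le)
    show "0 \<le> suminf m" using m m_gt_0 by (intro suminf_nonneg) (auto simp: less_imp_le)
    show "0 \<le> (\<Sum>x\<in>{0<..M}. (s x)\<^sup>2 * m x)"
      using m_gt_0 by (intro sum_nonneg) (auto simp: less_imp_le)
  qed
  finally have "(\<Sum>x\<in>{0<..M}. m x * s x)\<^sup>2 / (T M)\<^sup>2 \<le> suminf m * T M / (T M)\<^sup>2"
    by (rule divide_right_mono) simp
  then show ?thesis using T by (simp add: flux_def power_divide power2_eq_square[of "T M"])
qed

lemma Cap22_eq_0:
  assumes ns: "\<not> summable (\<lambda>x. (s x)\<^sup>2 * m x)" and m: "summable m"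
  shows "Cap22 b m = 0"
proof (rule antisym)
  have "0 \<le> H2_norm_sq b m f" for f using energy_nonneg[of f] by (simp add: H2_norm_sq_def)
  then show "0 \<le> Cap22 b m" unfolding Cap22_eq_INF[OF m] by (intro INF_greatest) simp
  have T_top: "filterlim T at_top sequentially"
    unfolding T_def[abs_def] using m_gt_0
    by (intro nonneg_not_summable_at_top ns) (simp add: less_imp_le)
  have inv: "(\<lambda>M. K / T M) \<longlonglongrightarrow> 0" for K
    by (rule tendsto_divide_0[OF tendsto_const filterlim_at_top_imp_at_infinity[OF T_top]])
  have "Cap22 b m \<le> 0 + ereal e" if e: "0 < e" for e
  proof -
    \<comment> \<open>\<open>N\<close> makes the tail of \<open>m\<close> small. With
      \<open>N\<close> fixed, \<open>?B\<close>, the remaining terms with the flux replaced by its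
      bound, tends to 0 in M.\<close>
    from suminf_exist_split[OF half_gt_zero[OF e] m] obtain N
      where N: "norm (\<Sum>i. m (i + N)) < e / 2" by blast
    let ?B = "\<lambda>M. suminf m / T M * T N + (suminf m / T M / m 0 + 1 / T M) + sqrt (suminf m / T M)"
    have "?B \<longlonglongrightarrow> 0 * T N + (0 / m 0 + 0) + sqrt 0"
      by (intro tendsto_intros inv) (use m_gt_0[of 0] in auto)
    then have "eventually (\<lambda>M. ?B M < e / 2) sequentially"
      using e by (intro order_tendstoD) auto
    moreover have "eventually (\<lambda>M. 0 < T M) sequentially"
      using T_top by (simp add: filterlim_at_top_dense)
    ultimately have "eventually (\<lambda>M. ?B M < e / 2 \<and> 0 < T M) sequentially"
      by (rule eventually_conj)
    then obtain M where B: "?B M < e / 2" and T: "0 < T M"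
      unfolding eventually_sequentially by blast
    let ?J = "flux M 0"
    note J2 = flux_sq_le[OF m T]
    have "?J \<le> sqrt (suminf m / T M)" using J2 by (rule real_le_rsqrt)
    moreover have "?J\<^sup>2 * T N \<le> suminf m / T M * T N"
      using J2 T_nonneg by (rule mult_right_mono)
    moreover have "?J\<^sup>2 / m 0 \<le> suminf m / T M / m 0"
      using J2 less_imp_le[OF m_gt_0] by (rule divide_right_mono)
    ultimately have "H2_norm_sq b m (equi M) \<le> e"
      using equi_H2_bound[OF m T, of N] B N unfolding real_norm_def by linarith
    moreover have "equi M \<in> cap_class b m M" using m T by (simp add: cap_class_eq equi_eq_1)
    ultimately have "(INF f\<in>cap_class b m M. ereal (H2_norm_sq b m f)) \<le> ereal e"
      by (intro INF_lower2[of "equi M"]) simp_all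
    then show ?thesis
      unfolding Cap22_eq_INF[OF m] by (simp add: INF_lower2[of M])
  qed
  then show "Cap22 b m \<le> 0" by (rule ereal_le_epsilon2)
qed

theorem Cap22_0_or_infinity_iff:
  "Cap22 b m = 0 \<or> Cap22 b m = \<infinity> \<longleftrightarrow> \<not> summable (\<lambda>x. (s x)\<^sup>2 * m x)"
proof (cases "summable m")
  case True
  show ?thesis
  proof (cases "summable (\<lambda>x. (s x)\<^sup>2 * m x)")
    case s: True
    then show ?thesis using Cap22_pos_finite[OF s] by simp
  next
    case False
    then show ?thesis using Cap22_eq_0[OF False True] by simp
  qed
next
  case False
  then have "Cap22 b m = \<infinity>" by (simp add: Cap22_def cap_class_eq)
  then show ?thesis using False summable_m by blast
qed

text \<open>The inner sum up to r is \<open>s\<close> at r + 1, so the series is that of s^2 m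
  without its term at 0.\<close>

lemma not_summable_iff_ennreal:
  "(\<Sum>r. ennreal ((\<Sum>k=0..r. 1 / b k (k + 1))\<^sup>2 * m (r + 1))) = \<infinity> \<longleftrightarrow>
     \<not> summable (\<lambda>x. (s x)\<^sup>2 * m x)"
proof -
  let ?h = "\<lambda>r. (s (Suc r))\<^sup>2 * m (Suc r)"
  have h: "(\<Sum>k=0..r. 1 / b k (k + 1))\<^sup>2 * m (r + 1) = ?h r" for r
    by (simp add: s_def \<beta>_def atLeast0AtMost lessThan_Suc_atMost)
  have nn: "0 \<le> ?h r" for r using m_gt_0[of "Suc r"] by simp
  have "summable ?h \<longleftrightarrow> (\<Sum>r. ennreal (?h r)) \<noteq> \<infinity>"
  proof
    assume "summable ?h"
    from suminf_ennreal2[OF nn this] show "(\<Sum>r. ennreal (?h r)) \<noteq> \<infinity>" by simp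
  next
    assume "(\<Sum>r. ennreal (?h r)) \<noteq> \<infinity>"
    then show "summable ?h" using nn by (intro summable_suminf_not_top) (simp_all add: top_ennreal_def)
  qed
  moreover have "summable ?h \<longleftrightarrow> summable (\<lambda>x. (s x)\<^sup>2 * m x)"
    by (rule summable_Suc_iff)
  ultimately show ?thesis unfolding h by blast
qed

end

section \<open>Star-like graphs\<close>

text \<open>Composition with \<open>w\<close> identifies the two sequence spaces, preserves inner
  products and intertwines the Laplacians.\<close>

lemma max_symmetric_reindex:
  fixes w :: "'b \<Rightarrow> 'a"
  assumes w: "inj w"
  shows "max_symmetric (range w) b m \<longleftrightarrow> max_symmetric UNIV (\<lambda>k l. b (w k) (w l)) (\<lambda>k. m (w k))"
    (is "_ \<longleftrightarrow> max_symmetric UNIV ?b ?m")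
proof -
  have ell2: "f \<in> ell2 (range w) m \<longleftrightarrow> (\<forall>x. x \<notin> range w \<longrightarrow> f x = 0) \<and> f \<circ> w \<in> ell2 UNIV ?m" for f
    using summable_on_reindex[OF w, of "\<lambda>x. (f x)\<^sup>2 * m x"] by (simp add: ell2_def o_def)
  have lap: "laplacian (range w) b m f \<circ> w = laplacian UNIV ?b ?m (f \<circ> w)" for f
  proof
    fix k
    show "(laplacian (range w) b m f \<circ> w) k = laplacian UNIV ?b ?m (f \<circ> w) k"
      using infsum_reindex[OF w, of "\<lambda>y. b (w k) y * (f (w k) - f y)"] by (simp add: laplacian_def o_def)
  qed
  have lap_ell2: "laplacian (range w) b m f \<in> ell2 (range w) m \<longleftrightarrow>
      laplacian UNIV ?b ?m (f \<circ> w) \<in> ell2 UNIV ?m" for f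
    unfolding ell2 lap by (simp add: laplacian_def)
  have inner: "ell2_inner (range w) m f g = ell2_inner UNIV ?m (f \<circ> w) (g \<circ> w)" for f g
    using infsum_reindex[OF w, of "\<lambda>x. f x * g x * m x"] by (simp add: ell2_inner_def o_def)
  have push: "\<exists>f\<in>ell2 (range w) m. f \<circ> w = F" if "F \<in> ell2 UNIV ?m" for F
  proof
    let ?f = "\<lambda>x. if x \<in> range w then F (inv w x) else 0"
    show fw: "?f \<circ> w = F" using w by (auto simp: fun_eq_iff)
    show "?f \<in> ell2 (range w) m" unfolding ell2 fw using that by simp
  qed
  show ?thesis
  proof
    assume sym: "max_symmetric (range w) b m"
    show "max_symmetric UNIV ?b ?m"
      unfolding max_symmetric_def
    proof (intro ballI impI)
      fix F G assume FG: "F \<in> ell2 UNIV ?m" "G \<in> ell2 UNIV ?m"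
        "laplacian UNIV ?b ?m F \<in> ell2 UNIV ?m" "laplacian UNIV ?b ?m G \<in> ell2 UNIV ?m"
      obtain f g where fg: "f \<in> ell2 (range w) m" "g \<in> ell2 (range w) m" "F = f \<circ> w" "G = g \<circ> w"
        using push[OF FG(1)] push[OF FG(2)] by blast
      have "laplacian (range w) b m f \<in> ell2 (range w) m" "laplacian (range w) b m g \<in> ell2 (range w) m"
        using FG(3,4) by (simp_all add: lap_ell2 fg(3,4))
      then have "ell2_inner (range w) m (laplacian (range w) b m f) g =
          ell2_inner (range w) m f (laplacian (range w) b m g)"
        using sym fg(1,2) unfolding max_symmetric_def by blast
      then show "ell2_inner UNIV ?m (laplacian UNIV ?b ?m F) G =
          ell2_inner UNIV ?m F (laplacian UNIV ?b ?m G)"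
        by (simp only: inner lap fg(3,4))
    qed
  next
    assume sym: "max_symmetric UNIV ?b ?m"
    show "max_symmetric (range w) b m"
      unfolding max_symmetric_def lap_ell2 inner lap
    proof (intro ballI impI)
      fix f g assume "f \<in> ell2 (range w) m" "g \<in> ell2 (range w) m"
        and L: "laplacian UNIV ?b ?m (f \<circ> w) \<in> ell2 UNIV ?m" "laplacian UNIV ?b ?m (g \<circ> w) \<in> ell2 UNIV ?m"
      then have "f \<circ> w \<in> ell2 UNIV ?m" "g \<circ> w \<in> ell2 UNIV ?m" by (simp_all add: ell2)
      then show "ell2_inner UNIV ?m (laplacian UNIV ?b ?m (f \<circ> w)) (g \<circ> w) =
          ell2_inner UNIV ?m (f \<circ> w) (laplacian UNIV ?b ?m (g \<circ> w))"
        using sym[unfolded max_symmetric_def, rule_format] L by simp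
    qed
  qed
qed

lemma graph_weights_subset:
  assumes "weighted_graph X b m" "assumption_A X b m" "V \<subseteq> X"
  shows "graph_weights V m b"
proof
  fix x y assume "x \<in> V" and y: "y \<in> V"
  then have x: "x \<in> X" "y \<in> X" using assms(3) by auto
  show "0 < m x" "0 \<le> b x y" "b x y = b y x"
    using assms(1) x by (simp_all add: weighted_graph_def)
  show "b x summable_on V" "(\<lambda>y. (b x y)\<^sup>2 / m y) summable_on V"
    using assms x by (auto simp: weighted_graph_def assumption_A_def
        intro: summable_on_subset_banach[OF _ assms(3)])
qed

text \<open>Serves the labels outside the index set, whose fibres are empty.\<close>

lemma max_symmetric_empty: "max_symmetric {} b m"
  by (simp add: max_symmetric_def ell2_inner_def)

text \<open>Edges between different chains vanish, so the edges cut at a vertex are precisely those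
  counted by the boundary degree. The part \<open>X1\<close> is symmetric by assumption, and only
  the chains remain.\<close>

lemma star_like_max_symmetric_iff:
  assumes star: "star_like X b m X1 I v"
  shows "max_symmetric X b m \<longleftrightarrow> (\<forall>i\<in>I. max_symmetric (range (v i)) b m)"
proof -
  have G: "weighted_graph X b m" "assumption_A X b m" and X1: "X1 \<subseteq> X"
    and esa: "essentially_self_adjoint X1 m (L_c X1 b m)"
    and bdd: "bounded (boundary_degree X b m X1 ` X)"
    and bij: "bij_betw (\<lambda>(i, k). v i k) (I \<times> UNIV) (X - X1)"
    and disj: "\<And>i j k l. i \<in> I \<Longrightarrow> j \<in> I \<Longrightarrow> i \<noteq> j \<Longrightarrow> b (v i k) (v j l) = 0"
    using star unfolding star_like_def disjoint_union_of_chains_def by auto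
  interpret graph_weights X m b using graph_weights_subset[OF G] by simp
  have v_mem: "v i k \<in> X - X1" if "i \<in> I" for i k
    using bij_betw_apply[OF bij, of "(i, k)"] that by simp
  have v_inj: "i = j" if "v i k = v j l" "i \<in> I" "j \<in> I" for i j k l
    using bij_betw_imp_inj_on[OF bij] that by (auto simp: inj_on_def)
  \<comment> \<open>\<open>None\<close> labels \<open>X1\<close> and \<open>Some i\<close> the i-th
    chain; the choice is unambiguous since the chains are disjoint.\<close>
  define p where "p x = (if x \<in> X1 then None else Some (SOME i. i \<in> I \<and> x \<in> range (v i)))" for x
  have p_v: "p (v i k) = Some i" if "i \<in> I" for i k
  proof -
    have "(SOME j. j \<in> I \<and> v i k \<in> range (v j)) = i"
      using that v_inj by (intro some_equality) auto
    then show ?thesis using v_mem[OF that] by (simp add: p_def)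
  qed
  have cases_X: "x \<in> X1 \<or> (\<exists>i\<in>I. \<exists>k. x = v i k)" if "x \<in> X" for x
    using that bij_betw_imp_surj_on[OF bij] by force
  obtain B where B: "\<And>x. x \<in> X \<Longrightarrow> \<bar>boundary_degree X b m X1 x\<bar> \<le> B"
    using bdd by (auto simp: bounded_iff)
  have degree: "boundary_degree X b m X1 x = (\<Sum>\<^sub>\<infinity>y\<in>{y\<in>X. p y \<noteq> p x}. b x y) / m x" if x: "x \<in> X" for x
    using cases_X[OF x]
  proof (elim disjE bexE exE)
    assume "x \<in> X1"
    moreover from this have "{y\<in>X. p y \<noteq> p x} = X - X1" by (auto simp: p_def)
    ultimately show ?thesis by (simp add: boundary_degree_def)
  next
    fix i k assume i: "i \<in> I" and xv: "x = v i k"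
    have "(\<Sum>\<^sub>\<infinity>y\<in>{y\<in>X. p y \<noteq> p x}. b x y) = (\<Sum>\<^sub>\<infinity>y\<in>X1. b x y)"
    proof (rule infsum_cong_neutral)
      fix y assume "y \<in> X1 - {y\<in>X. p y \<noteq> p x}"
      then show "b x y = 0" using X1 p_v[OF i] by (auto simp: xv p_def)
    next
      fix y assume y: "y \<in> {y\<in>X. p y \<noteq> p x} - X1"
      then obtain j l where "j \<in> I" "y = v j l" using cases_X by blast
      then show "b x y = 0" using y i by (auto simp: xv p_v disj)
    qed simp
    then show ?thesis using v_mem[OF i] by (simp add: boundary_degree_def xv)
  qed
  \<comment> \<open>The cut constant has to be strictly positive, whereas \<open>B\<close> may be
    0.\<close>
  interpret partitioned_graph X m b p "\<bar>B\<bar> + 1"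
  proof
    fix x assume x: "x \<in> X"
    have "(\<Sum>\<^sub>\<infinity>y\<in>{y\<in>X. p y \<noteq> p x}. b x y) / m x \<le> \<bar>B\<bar> + 1"
      using B[OF x] degree[OF x] by linarith
    then show "(\<Sum>\<^sub>\<infinity>y\<in>{y\<in>X. p y \<noteq> p x}. b x y) \<le> (\<bar>B\<bar> + 1) * m x"
      using m_pos[OF x] by (simp add: field_simps)
  qed simp
  have "fibre None = X1" using X1 by (auto simp: fibre_def p_def)
  then have 1: "max_symmetric (fibre None) b m"
    using esa graph_weights.essentially_self_adjoint_iff_max_symmetric[OF graph_weights_subset[OF G X1]]
    by simp
  have 2: "fibre (Some i) = (if i \<in> I then range (v i) else {})" for i
  proof (intro equalityI subsetI)
    fix x assume "x \<in> fibre (Some i)"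
    then have x: "x \<in> X" "p x = Some i" by (auto simp: fibre_def)
    then have "x \<notin> X1" by (auto simp: p_def)
    then obtain j k where "j \<in> I" "x = v j k" using cases_X x(1) by blast
    then show "x \<in> (if i \<in> I then range (v i) else {})" using x(2) p_v by auto
  next
    fix x assume "x \<in> (if i \<in> I then range (v i) else {})"
    then show "x \<in> fibre (Some i)" using p_v v_mem by (auto simp: fibre_def split: if_splits)
  qed
  have "max_symmetric (fibre (Some i)) b m \<longleftrightarrow> (i \<in> I \<longrightarrow> max_symmetric (range (v i)) b m)" for i
    by (simp add: 2 max_symmetric_empty)
  then show ?thesis
    unfolding max_symmetric_iff_fibres using 1 by (simp add: split_option_all) blast
qed

theorem theorem4p30:
  fixes X X1 :: "'a set" and b :: "'a \<Rightarrow> 'a \<Rightarrow> real" and m :: "'a \<Rightarrow> real"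
    and I :: "'i set" and v :: "'i \<Rightarrow> nat \<Rightarrow> 'a"
  assumes "star_like X b m X1 I v"
  shows "(essentially_self_adjoint X m (L_c X b m)
           \<longleftrightarrow> (\<forall>i\<in>I. essentially_self_adjoint (range (v i)) m (L_c (range (v i)) b m)))
       \<and> ((\<forall>i\<in>I. essentially_self_adjoint (range (v i)) m (L_c (range (v i)) b m))
           \<longleftrightarrow> (\<forall>i\<in>I. (\<Sum>r. ennreal ((\<Sum>k=0..r. 1 / b (v i k) (v i (k + 1)))\<^sup>2 * m (v i (r + 1)))) = \<infinity>))
       \<and> ((\<forall>i\<in>I. (\<Sum>r. ennreal ((\<Sum>k=0..r. 1 / b (v i k) (v i (k + 1)))\<^sup>2 * m (v i (r + 1)))) = \<infinity>)
           \<longleftrightarrow> (\<forall>i\<in>I. Cap22 (chain_b b (v i)) (chain_m m (v i)) = 0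
                    \<or> Cap22 (chain_b b (v i)) (chain_m m (v i)) = \<infinity>))"
proof -
  have G: "weighted_graph X b m" "assumption_A X b m"
    and bij: "bij_betw (\<lambda>(i, k). v i k) (I \<times> UNIV) (X - X1)"
    and chains: "\<And>i. i \<in> I \<Longrightarrow> birth_death_chain (chain_b b (v i)) (chain_m m (v i))"
    using assms unfolding star_like_def disjoint_union_of_chains_def by auto
  have esa: "essentially_self_adjoint V m (L_c V b m) \<longleftrightarrow> max_symmetric V b m" if "V \<subseteq> X" for V
    by (rule graph_weights.essentially_self_adjoint_iff_max_symmetric[OF graph_weights_subset[OF G that]])
  have sub: "range (v i) \<subseteq> X" if "i \<in> I" for i
    using bij_betw_apply[OF bij] that by fastforce
  have inj: "inj (v i)" if "i \<in> I" for i
    using bij_betw_imp_inj_on[OF bij] that by (auto simp: inj_on_def)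
  have sym: "max_symmetric (range (v i)) b m \<longleftrightarrow>
      (\<Sum>r. ennreal ((\<Sum>k=0..r. 1 / b (v i k) (v i (k + 1)))\<^sup>2 * m (v i (r + 1)))) = \<infinity>"
    and cap: "(\<Sum>r. ennreal ((\<Sum>k=0..r. 1 / b (v i k) (v i (k + 1)))\<^sup>2 * m (v i (r + 1)))) = \<infinity> \<longleftrightarrow>
      Cap22 (chain_b b (v i)) (chain_m m (v i)) = 0 \<or> Cap22 (chain_b b (v i)) (chain_m m (v i)) = \<infinity>"
    if i: "i \<in> I" for i
  proof -
    interpret birth_death "chain_b b (v i)" "chain_m m (v i)" using chains[OF i] by unfold_locales
    have series: "(\<Sum>r. ennreal ((\<Sum>k=0..r. 1 / b (v i k) (v i (k + 1)))\<^sup>2 * m (v i (r + 1)))) = \<infinity>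
        \<longleftrightarrow> \<not> summable (\<lambda>x. (s x)\<^sup>2 * chain_m m (v i) x)"
      using not_summable_iff_ennreal by (simp add: chain_b_def chain_m_def)
    show "max_symmetric (range (v i)) b m \<longleftrightarrow>
        (\<Sum>r. ennreal ((\<Sum>k=0..r. 1 / b (v i k) (v i (k + 1)))\<^sup>2 * m (v i (r + 1)))) = \<infinity>"
      using series max_symmetric_iff_not_summable max_symmetric_reindex[OF inj[OF i], of b m]
      by (simp add: chain_b_def chain_m_def)
    show "(\<Sum>r. ennreal ((\<Sum>k=0..r. 1 / b (v i k) (v i (k + 1)))\<^sup>2 * m (v i (r + 1)))) = \<infinity> \<longleftrightarrow>
        Cap22 (chain_b b (v i)) (chain_m m (v i)) = 0 \<or> Cap22 (chain_b b (v i)) (chain_m m (v i)) = \<infinity>"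
      unfolding series Cap22_0_or_infinity_iff ..
  qed
  show ?thesis
    using star_like_max_symmetric_iff[OF assms] esa[OF order_refl] esa[OF sub] sym cap by simp
qed

end
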